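(* Let $H'$ be a Hilbert space and $X$ a compact Hausdorff space. Then $H=C(X,H')$ is a Hilbert $C(X)$-module. Moreover, if $\{e_n\}_{n=0}^{\infty}\subseteq H'$ is a stationary sequence of complete unit vectors such that $\{\langle e_0,e_n\rangle\}_{n=0}^{\infty}$ are the non-negative Fourier coefficients of a singular Borel probability measure on $[0,1)$, then the sequence $\{e_n\}_{n=0}^{\infty}\subseteq H$, where $e_n$ now denotes the element of $C(X,H')$ that is constant in $X$ with value $e_n$, is effective in $H$.
   Context: $C(X,H')$ is the space of norm-continuous functions $X\to H'$ with pointwise module action of $C(X)$ and pointwise inner product $\langle f,g\rangle(x)=\langle f(x),g(x)\rangle_{H'}$ (linear in the first variable), with norm $\|f\|=\sqrt{\|\langle f,f\rangle\|_{C(X)}}$. A Hilbert $A$-module ($A$ a unital $C^*$-algebra) is a complex vector space and left $A$-module $H$ with an inner product $\langle\cdot,\cdot\rangle:H\times H\to A$ such that $\langle x,x\rangle\ge 0$ with equality iff $x=0$, $\langle x,y\rangle=\langle y,x\rangle^*$, and $\langle ax+by,z\rangle=a\langle x,z\rangle+b\langle y,z\rangle$ for $a,b\in A$, and which is complete in the norm $\|x\|=\sqrt{\|\langle x,x\rangle\|_A}$. A sequence in $H'$ is complete if its linear span is dense in $H'$; it is stationary if there is a linear isometry $T:H'\to H'$ with $T^ne_0=e_n$ for all $n$. The non-negative Fourier coefficients of a Borel probability measure $\mu$ on $[0,1)$ are $\int_0^1e^{-2\pi i ny}\,d\mu(y)$, $n\ge0$; singular means singular with respect to Lebesgue measure.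 A sequence $\{e_n\}_{n=0}^\infty$ in a Hilbert $A$-module $H$ with $\langle e_n,e_n\rangle=I$ (the unit of $A$) for all $n$ is called effective if for every $x\in H$ the sequence defined by $x_0=\langle x,e_0\rangle e_0$ and $x_n=x_{n-1}+\langle x-x_{n-1},e_n\rangle e_n$ for $n\ge1$ converges to $x$ in norm. *)

theory Defs
  imports
    "HOL-Probability.Probability"
    "HOL-Algebra.Module"
begin

section \<open>Complex Hilbert spaces\<close>

text \<open>The inner product is linear in its \<^emph>\<open>first\<close> argument.\<close>

class complex_inner = real_normed_vector +
  fixes scaleC :: "complex \<Rightarrow> 'a \<Rightarrow> 'a"
    and cinner :: "'a \<Rightarrow> 'a \<Rightarrow> complex"
  assumes scaleC_add_right: "scaleC c (x + y) = scaleC c x + scaleC c y"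
    and scaleC_add_left: "scaleC (c + d) x = scaleC c x + scaleC d x"
    and scaleC_scaleC: "scaleC c (scaleC d x) = scaleC (c * d) x"
    and scaleR_scaleC: "scaleR r x = scaleC (complex_of_real r) x"
    and cinner_add_left: "cinner (x + y) z = cinner x z + cinner y z"
    and cinner_scaleC_left: "cinner (scaleC c x) y = c * cinner x y"
    and cinner_commute: "cinner x y = cnj (cinner y x)"
    and cinner_ge_zero: "0 \<le> Re (cinner x x)"
    and cinner_eq_zero_iff: "cinner x x = 0 \<longleftrightarrow> x = 0"
    and norm_eq_sqrt_cinner: "norm x = sqrt (Re (cinner x x))"

class chilbert_space = complex_inner + complete_space

definition clinear_isometry :: "('h::complex_inner \<Rightarrow> 'h) \<Rightarrow> bool" where
  "clinear_isometry T \<longleftrightarrow>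
     (\<forall>x y. T (x + y) = T x + T y) \<and>
     (\<forall>c x. T (scaleC c x) = scaleC c (T x)) \<and>
     (\<forall>x. norm (T x) = norm x)"

definition stationary :: "(nat \<Rightarrow> 'h::complex_inner) \<Rightarrow> bool" where
  "stationary e \<longleftrightarrow> (\<exists>T. clinear_isometry T \<and> (\<forall>n. (T ^^ n) (e 0) = e n))"

definition complete_seq :: "(nat \<Rightarrow> 'h::complex_inner) \<Rightarrow> bool" where
  "complete_seq e \<longleftrightarrow> closure (Modules.module.span scaleC (range e)) = UNIV"


section \<open>Unital C*-algebras\<close>

text \<open>
  Algebraic structures are records with an explicit carrier set. Scalar multiplication by complex
  numbers is the field \<open>smult\<close> inherited from the library's modules. The zero algebra is allowed.
\<close>

definition complex_ring :: "complex ring" where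
  "complex_ring = \<lparr>carrier = UNIV, monoid.mult = (*), one = 1, ring.zero = 0, add = (+)\<rparr>"

record 'a cstar = "(complex, 'a) module" +
  adj :: "'a \<Rightarrow> 'a"
  cnorm :: "'a \<Rightarrow> real"

definition complete_wrt :: "('b, 'm) ring_scheme \<Rightarrow> ('b \<Rightarrow> real) \<Rightarrow> bool" where
  "complete_wrt G N \<longleftrightarrow>
     (\<forall>s. (\<forall>n. s n \<in> carrier G) \<and>
          (\<forall>\<epsilon>>0. \<exists>K::nat. \<forall>m\<ge>K. \<forall>n\<ge>K. N (s m \<ominus>\<^bsub>G\<^esub> s n) < \<epsilon>) \<longrightarrow>
          (\<exists>l\<in>carrier G. (\<lambda>n. N (s n \<ominus>\<^bsub>G\<^esub> l)) \<longlonglongrightarrow> 0))"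

locale unital_cstar_algebra =
  fixes A :: "('a, 'm) cstar_scheme" (structure)
  assumes ring: "ring A"
    and complex_vector_space: "module complex_ring A"
    and smult_mult_left: "\<lbrakk>a \<in> carrier A; b \<in> carrier A\<rbrakk> \<Longrightarrow>
          (c \<odot> a) \<otimes> b = c \<odot> (a \<otimes> b)"
    and smult_mult_right: "\<lbrakk>a \<in> carrier A; b \<in> carrier A\<rbrakk> \<Longrightarrow>
          a \<otimes> (c \<odot> b) = c \<odot> (a \<otimes> b)"
    and adjoint_closed: "a \<in> carrier A \<Longrightarrow> adj A a \<in> carrier A"
    and adjoint_adjoint: "a \<in> carrier A \<Longrightarrow> adj A (adj A a) = a"
    and adjoint_add: "\<lbrakk>a \<in> carrier A; b \<in> carrier A\<rbrakk> \<Longrightarrow>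
          adj A (a \<oplus> b) = adj A a \<oplus> adj A b"
    and adjoint_smult: "a \<in> carrier A \<Longrightarrow> adj A (c \<odot> a) = cnj c \<odot> adj A a"
    and adjoint_mult: "\<lbrakk>a \<in> carrier A; b \<in> carrier A\<rbrakk> \<Longrightarrow>
          adj A (a \<otimes> b) = adj A b \<otimes> adj A a"
    and cnorm_nonneg: "a \<in> carrier A \<Longrightarrow> 0 \<le> cnorm A a"
    and cnorm_eq_zero_iff: "a \<in> carrier A \<Longrightarrow> cnorm A a = 0 \<longleftrightarrow> a = \<zero>"
    and cnorm_triangle: "\<lbrakk>a \<in> carrier A; b \<in> carrier A\<rbrakk> \<Longrightarrow>
          cnorm A (a \<oplus> b) \<le> cnorm A a + cnorm A b"
    and cnorm_smult: "a \<in> carrier A \<Longrightarrow> cnorm A (c \<odot> a) = cmod c * cnorm A a"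
    and cnorm_mult: "\<lbrakk>a \<in> carrier A; b \<in> carrier A\<rbrakk> \<Longrightarrow>
          cnorm A (a \<otimes> b) \<le> cnorm A a * cnorm A b"
    and cstar_identity: "a \<in> carrier A \<Longrightarrow> cnorm A (adj A a \<otimes> a) = (cnorm A a)\<^sup>2"
    and norm_complete: "complete_wrt A (cnorm A)"

definition cstar_positive :: "('a, 'm) cstar_scheme \<Rightarrow> 'a \<Rightarrow> bool" where
  "cstar_positive A a \<longleftrightarrow> (\<exists>b\<in>carrier A. a = adj A b \<otimes>\<^bsub>A\<^esub> b)"


section \<open>Hilbert modules\<close>

text \<open>
  Only \<open>carrier\<close>, \<open>add\<close>, \<open>zero\<close> and \<open>smult\<close> of the underlying record are meaningful;
  its ring multiplication and unit are never used.
\<close>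

record ('a, 'h) hilbert_mod = "(complex, 'h) module" +
  act :: "'a \<Rightarrow> 'h \<Rightarrow> 'h"
  ip :: "'h \<Rightarrow> 'h \<Rightarrow> 'a"

definition hnorm ::
  "('a, 'm) cstar_scheme \<Rightarrow> ('a, 'h, 'n) hilbert_mod_scheme \<Rightarrow> 'h \<Rightarrow> real" where
  "hnorm A H x = sqrt (cnorm A (ip H x x))"

text \<open>
  The library's \<^locale>\<open>module\<close> requires a commutative ring of scalars, so the axioms of a left
  module over \<open>A\<close> are spelled out.
\<close>

locale hilbert_module =
  fixes A :: "('a, 'm) cstar_scheme" and H :: "('a, 'h, 'n) hilbert_mod_scheme"
  assumes cstar_algebra: "unital_cstar_algebra A"
    and complex_vector_space: "module complex_ring H"
    and act_closed: "\<lbrakk>a \<in> carrier A; x \<in> carrier H\<rbrakk> \<Longrightarrow> act H a x \<in> carrier H"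
    and act_add_left: "\<lbrakk>a \<in> carrier A; b \<in> carrier A; x \<in> carrier H\<rbrakk> \<Longrightarrow>
          act H (a \<oplus>\<^bsub>A\<^esub> b) x = act H a x \<oplus>\<^bsub>H\<^esub> act H b x"
    and act_add_right: "\<lbrakk>a \<in> carrier A; x \<in> carrier H; y \<in> carrier H\<rbrakk> \<Longrightarrow>
          act H a (x \<oplus>\<^bsub>H\<^esub> y) = act H a x \<oplus>\<^bsub>H\<^esub> act H a y"
    and act_mult: "\<lbrakk>a \<in> carrier A; b \<in> carrier A; x \<in> carrier H\<rbrakk> \<Longrightarrow>
          act H (a \<otimes>\<^bsub>A\<^esub> b) x = act H a (act H b x)"
    and act_one: "x \<in> carrier H \<Longrightarrow> act H \<one>\<^bsub>A\<^esub> x = x"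
    and act_smult_left: "\<lbrakk>a \<in> carrier A; x \<in> carrier H\<rbrakk> \<Longrightarrow>
          act H (c \<odot>\<^bsub>A\<^esub> a) x = c \<odot>\<^bsub>H\<^esub> act H a x"
    and act_smult_right: "\<lbrakk>a \<in> carrier A; x \<in> carrier H\<rbrakk> \<Longrightarrow>
          act H a (c \<odot>\<^bsub>H\<^esub> x) = c \<odot>\<^bsub>H\<^esub> act H a x"
    and ip_closed: "\<lbrakk>x \<in> carrier H; y \<in> carrier H\<rbrakk> \<Longrightarrow> ip H x y \<in> carrier A"
    and ip_positive: "x \<in> carrier H \<Longrightarrow> cstar_positive A (ip H x x)"
    and ip_eq_zero_iff: "x \<in> carrier H \<Longrightarrow> ip H x x = \<zero>\<^bsub>A\<^esub> \<longleftrightarrow> x = \<zero>\<^bsub>H\<^esub>"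
    and ip_commute: "\<lbrakk>x \<in> carrier H; y \<in> carrier H\<rbrakk> \<Longrightarrow> ip H x y = adj A (ip H y x)"
    and ip_linear: "\<lbrakk>a \<in> carrier A; b \<in> carrier A;
            x \<in> carrier H; y \<in> carrier H; z \<in> carrier H\<rbrakk> \<Longrightarrow>
          ip H (act H a x \<oplus>\<^bsub>H\<^esub> act H b y) z =
            (a \<otimes>\<^bsub>A\<^esub> ip H x z) \<oplus>\<^bsub>A\<^esub> (b \<otimes>\<^bsub>A\<^esub> ip H y z)"
    and norm_complete: "complete_wrt H (hnorm A H)"

primrec kaczmarz ::
  "('a, 'h, 'n) hilbert_mod_scheme \<Rightarrow> (nat \<Rightarrow> 'h) \<Rightarrow> 'h \<Rightarrow> nat \<Rightarrow> 'h" where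
  "kaczmarz H e x 0 = act H (ip H x (e 0)) (e 0)"
| "kaczmarz H e x (Suc n) =
     kaczmarz H e x n \<oplus>\<^bsub>H\<^esub>
       act H (ip H (x \<ominus>\<^bsub>H\<^esub> kaczmarz H e x n) (e (Suc n))) (e (Suc n))"

definition effective ::
  "('a, 'm) cstar_scheme \<Rightarrow> ('a, 'h, 'n) hilbert_mod_scheme \<Rightarrow> (nat \<Rightarrow> 'h) \<Rightarrow> bool" where
  "effective A H e \<longleftrightarrow>
     (\<forall>n. e n \<in> carrier H \<and> ip H (e n) (e n) = \<one>\<^bsub>A\<^esub>) \<and>
     (\<forall>x\<in>carrier H. (\<lambda>n. hnorm A H (kaczmarz H e x n \<ominus>\<^bsub>H\<^esub> x)) \<longlonglongrightarrow> 0)"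


section \<open>Continuous functions on a topological space\<close>

text \<open>
  A function on \<open>topspace X\<close> is represented by its extension by \<open>undefined\<close>, so that equality
  in the carriers is equality on \<open>topspace X\<close>.
  Inserting \<open>0\<close> only matters when \<open>topspace X\<close> is empty: it makes the supremum \<open>0\<close> then.
\<close>

definition C_alg :: "'x topology \<Rightarrow> ('x \<Rightarrow> complex) cstar" where
  "C_alg X = \<lparr>
     carrier = {f \<in> extensional (topspace X). continuous_map X euclidean f},
     monoid.mult = (\<lambda>f g. \<lambda>x\<in>topspace X. f x * g x),
     one = (\<lambda>x\<in>topspace X. 1),
     ring.zero = (\<lambda>x\<in>topspace X. 0),
     add = (\<lambda>f g. \<lambda>x\<in>topspace X. f x + g x),
     smult = (\<lambda>c f. \<lambda>x\<in>topspace X. c * f x),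
     adj = (\<lambda>f. \<lambda>x\<in>topspace X. cnj (f x)),
     cnorm = (\<lambda>f. Sup (insert 0 ((\<lambda>x. cmod (f x)) ` topspace X)))\<rparr>"

definition C_mod ::
  "'x topology \<Rightarrow> ('x \<Rightarrow> complex, 'x \<Rightarrow> 'h::complex_inner) hilbert_mod" where
  "C_mod X = \<lparr>
     carrier = {f \<in> extensional (topspace X). continuous_map X euclidean f},
     monoid.mult = undefined,
     one = undefined,
     ring.zero = (\<lambda>x\<in>topspace X. 0),
     add = (\<lambda>f g. \<lambda>x\<in>topspace X. f x + g x),
     smult = (\<lambda>c f. \<lambda>x\<in>topspace X. scaleC c (f x)),
     act = (\<lambda>a f. \<lambda>x\<in>topspace X. scaleC (a x) (f x)),
     ip = (\<lambda>f g. \<lambda>x\<in>topspace X. cinner (f x) (g x))\<rparr>"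

definition const_seq :: "'x topology \<Rightarrow> (nat \<Rightarrow> 'h) \<Rightarrow> nat \<Rightarrow> 'x \<Rightarrow> 'h" where
  "const_seq X e n = (\<lambda>x\<in>topspace X. e n)"


section \<open>Measures on \<open>[0,1)\<close>\<close>

definition borel_prob_unit_interval :: "real measure \<Rightarrow> bool" where
  "borel_prob_unit_interval \<mu> \<longleftrightarrow>
     sets \<mu> = sets (restrict_space borel {0..<1}) \<and> prob_space \<mu>"

definition lebesgue_singular :: "real measure \<Rightarrow> bool" where
  "lebesgue_singular \<mu> \<longleftrightarrow>
     (\<exists>N\<in>sets \<mu>. emeasure lborel N = 0 \<and> emeasure \<mu> (space \<mu> - N) = 0)"

definition fourier_coeff :: "real measure \<Rightarrow> nat \<Rightarrow> complex" where
  "fourier_coeff \<mu> n = (\<integral>y. exp (- 2 * of_real pi * \<i> * of_nat n * of_real y) \<partial>\<mu>)"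

end

theory Submission
  imports Defs
begin

text \<open>
  Let \<open>P n\<close> be the orthogonal projection onto the complement of \<open>e n\<close> in \<open>H'\<close>. The Kaczmarz residual of
  \<open>v\<close> after step \<open>n\<close> is \<open>P n \<cdots> P 0 v\<close>, and in \<open>C(X,H')\<close> the iteration runs at each point of \<open>X\<close>
  separately. These products are linear contractions and a continuous function on \<open>X\<close> has compact image, so
  pointwise convergence in \<open>H'\<close> suffices (\<open>rejects_uniform_on_compact\<close>, \<open>effective_const_seq\<close>). By
  completeness of the sequence, it is enough to treat the vectors \<open>e k\<close>.

  With \<open>T\<close> the isometry that shifts the sequence, \<open>P (n+1) T = T (P n)\<close>. Induction on \<open>k\<close> then reduces
  everything to \<open>z n = P n \<cdots> P 1 (e 0)\<close>. If \<open>a n\<close> is the coefficient removed by \<open>P n\<close>, then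
  \<open>(norm (z n))\<^sup>2 = 1 - (\<Sum>i=1..n. \<bar>a i\<bar>\<^sup>2)\<close>, and stationarity gives \<open>(\<Sum>i\<le>n. a i m (n-i)) = m n\<close> for
  \<open>n \<ge> 1\<close>, where \<open>m\<close> are the Fourier coefficients of the measure and \<open>a 0 = 0\<close>. For the power series \<open>M\<close>
  and \<open>b\<close> of \<open>m\<close> and \<open>a\<close> this reads \<open>b = 1 - 1/M\<close>. Since \<open>2 Re M - 1\<close> is the Poisson integral \<open>P\<close> of
  the measure, \<open>1 - \<bar>b\<bar>\<^sup>2 = P / \<bar>M\<bar>\<^sup>2 \<le> 4 P\<close>. The Poisson integral of a singular measure tends to \<open>0\<close> in
  Lebesgue measure at the boundary, so \<open>b\<close> is inner, its Taylor coefficients satisfy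
  \<open>(\<Sum>i. \<bar>a i\<bar>\<^sup>2) = 1\<close> (\<open>inner_function_of_singular_measure\<close>), and \<open>z n\<close> tends to \<open>0\<close>
  (\<open>kwapien_mycielski_singular\<close>).

  That \<open>C(X,H')\<close> is a Hilbert module is pointwise algebra, together with completeness under uniform
  limits (\<open>cont_funs_complete\<close>).
\<close>

section \<open>Fourier series on the unit interval\<close>

text \<open>
  A density with respect to Lebesgue measure, not a restriction to a subspace, so that the Borel sets
  of the whole line are the measurable sets and functions on the line can be integrated as they stand.
\<close>

definition unif01 :: "real measure" where
  "unif01 = density lborel (\<lambda>x. ennreal (indicator {0..1} x))"

lemma sets_unif01 [simp, measurable_cong]: "sets unif01 = sets borel"
  by (simp add: unif01_def)

lemma space_unif01 [simp]: "space unif01 = UNIV"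
  by (simp add: unif01_def)

interpretation unif01: prob_space unif01
proof
  show "emeasure unif01 (space unif01) = 1"
    unfolding unif01_def by (subst emeasure_density) (auto simp: ennreal_indicator)
qed

lemma integral_unif01_FTC:
  fixes f :: "real \<Rightarrow> 'a :: euclidean_space"
  assumes "\<And>x. (F has_vector_derivative f x) (at x)" and "continuous_on UNIV f"
  shows "integral\<^sup>L unif01 f = F 1 - F 0"
proof -
  have "integral\<^sup>L unif01 f = (\<integral>x. indicator {0..1} x *\<^sub>R f x \<partial>lborel)"
    unfolding unif01_def
    by (rule integral_density) (use assms(2) in \<open>auto intro: borel_measurable_continuous_onI\<close>)
  also have "\<dots> = F 1 - F 0"
    by (rule integral_FTC_Icc)
       (use assms in \<open>auto intro: has_vector_derivative_at_within continuous_on_subset\<close>)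
  finally show ?thesis .
qed

lemma integral_cis_orthogonal:
  "(\<integral>t. cis (2 * pi * t) ^ n * cnj (cis (2 * pi * t) ^ m) \<partial>unif01) = (if n = m then 1 else 0)"
proof (cases "n = m")
  case True
  have "cis (2 * pi * t) ^ m * cnj (cis (2 * pi * t) ^ m) = 1" for t
    by (simp only: complex_norm_square[symmetric]) (simp add: norm_power)
  then show ?thesis using True unif01.prob_space by simp
next
  case False
  define k where "k = 2 * pi * (real n - real m)"
  have k: "k \<noteq> 0" using False by (simp add: k_def)
  have eq: "cis (2 * pi * t) ^ n * cnj (cis (2 * pi * t) ^ m) = cis (k * t)" for t
  proof -
    have "k * t = real n * (2 * pi * t) + - (real m * (2 * pi * t))" by (simp add: k_def algebra_simps)
    then show ?thesis by (simp only: Complex.DeMoivre cis_cnj cis_mult complex_cnj_power)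
  qed
  have "(\<integral>t. cis (k * t) \<partial>unif01) = - \<i> * cis (k * 1) / k - - \<i> * cis (k * 0) / k"
    by (rule integral_unif01_FTC)
       (use k in \<open>auto intro!: derivative_eq_intros continuous_intros
          simp: has_vector_derivative_def fun_eq_iff scaleR_conv_of_real field_simps\<close>)
  also have "cis (k * 1) = 1"
    using cis_multiple_2pi[of "real n - real m"] by (simp add: k_def mult.commute)
  finally show ?thesis using False unfolding eq by simp
qed

text \<open>
  Absolute convergence makes the partial sums uniformly bounded, so their Parseval identity, which is
  orthogonality of the characters, passes to the limit by dominated convergence.
\<close>

lemma parseval_absolutely_summable:
  fixes c :: "nat \<Rightarrow> complex"
  assumes c: "summable (\<lambda>n. cmod (c n))"
  defines "f \<equiv> \<lambda>t. (cmod (\<Sum>n. c n * cis (2 * pi * t) ^ n))\<^sup>2"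
  shows "integrable unif01 f" and "(\<lambda>n. (cmod (c n))\<^sup>2) sums integral\<^sup>L unif01 f"
proof -
  define E where "E = (\<lambda>t n. cis (2 * pi * t) ^ n)"
  have nE: "cmod (c n * E t n) = cmod (c n)" for n t
    by (simp add: E_def norm_mult norm_power)
  have [measurable]: "(\<lambda>t. E t n) \<in> borel_measurable borel" for n
    unfolding E_def by (intro borel_measurable_continuous_onI continuous_intros)
  define S where "S = (\<lambda>N t. \<Sum>n<N. c n * E t n)"
  have S[measurable]: "S N \<in> borel_measurable borel" for N unfolding S_def by measurable
  have lim: "(\<lambda>N. S N t) \<longlonglongrightarrow> (\<Sum>n. c n * E t n)" for t
    unfolding S_def using summable_LIMSEQ[OF summable_norm_cancel, of "\<lambda>n. c n * E t n"] c
    by (simp add: nE)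
  define B where "B = (\<Sum>n. cmod (c n))"
  have bound: "cmod (S N t) \<le> B" for N t
  proof -
    have "cmod (S N t) \<le> (\<Sum>n<N. cmod (c n))"
      unfolding S_def by (rule order_trans[OF norm_sum]) (simp add: nE)
    also have "\<dots> \<le> B" unfolding B_def by (intro sum_le_suminf c) auto
    finally show ?thesis .
  qed
  have partial: "(\<integral>t. (cmod (S N t))\<^sup>2 \<partial>unif01) = (\<Sum>n<N. (cmod (c n))\<^sup>2)" for N
  proof -
    have [measurable]: "(\<lambda>t. E t n * cnj (E t m)) \<in> borel_measurable borel" for n m
      unfolding E_def by (intro borel_measurable_continuous_onI continuous_intros)
    have int: "integrable unif01 (\<lambda>t. E t n * cnj (E t m))" for n m
    proof (rule unif01.integrable_const_bound[where B=1])
      show "AE t in unif01. cmod (E t n * cnj (E t m)) \<le> 1"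
        by (simp add: E_def norm_mult norm_power)
    qed measurable
    have "complex_of_real (\<integral>t. (cmod (S N t))\<^sup>2 \<partial>unif01) = (\<integral>t. S N t * cnj (S N t) \<partial>unif01)"
      by (subst integral_complex_of_real[symmetric], simp only: complex_norm_square)
    also have "\<dots> = (\<integral>t. (\<Sum>n<N. \<Sum>m<N. c n * cnj (c m) * (E t n * cnj (E t m))) \<partial>unif01)"
      by (simp add: S_def sum_product algebra_simps)
    also have "\<dots> = (\<Sum>n<N. \<Sum>m<N. c n * cnj (c m) * (if n = m then 1 else 0))"
      using int integral_cis_orthogonal
      by (subst Bochner_Integration.integral_sum, force)+ (simp add: E_def)
    also have "\<dots> = complex_of_real (\<Sum>n<N. (cmod (c n))\<^sup>2)"
      by (simp add: complex_norm_square[symmetric] if_distrib cong: if_cong)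
    finally show ?thesis by (simp only: of_real_eq_iff)
  qed
  have f: "f = (\<lambda>t. (cmod (\<Sum>n. c n * E t n))\<^sup>2)" by (simp add: f_def E_def)
  have lim_AE: "AE t in unif01. (\<lambda>N. (cmod (S N t))\<^sup>2) \<longlonglongrightarrow> (cmod (\<Sum>n. c n * E t n))\<^sup>2"
    by (intro AE_I2 tendsto_intros lim)
  have bound_AE: "AE t in unif01. norm ((cmod (S N t))\<^sup>2) \<le> B\<^sup>2" for N
    using bound by (intro AE_I2) (simp add: power_mono)
  show "integrable unif01 f"
    unfolding f by (rule integrable_dominated_convergence[OF _ _ _ lim_AE bound_AE]) auto
  have "(\<lambda>N. \<integral>t. (cmod (S N t))\<^sup>2 \<partial>unif01) \<longlonglongrightarrow> integral\<^sup>L unif01 f"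
    unfolding f by (rule integral_dominated_convergence[OF _ _ _ lim_AE bound_AE]) auto
  then show "(\<lambda>n. (cmod (c n))\<^sup>2) sums integral\<^sup>L unif01 f"
    by (simp add: sums_def partial)
qed

section \<open>The Poisson kernel\<close>

text \<open>
  The classical kernel \<open>(1 - r\<^sup>2) / \<bar>1 - r exp(2 \<pi> i s)\<bar>\<^sup>2\<close>, with period \<open>1\<close>.
\<close>

definition poisson :: "real \<Rightarrow> real \<Rightarrow> real" where
  "poisson r s = (1 - r\<^sup>2) / (cmod (1 - of_real r * cis (2 * pi * s)))\<^sup>2"

text \<open>
  With \<open>w = r cis (2 \<pi> s)\<close> the right-hand side is the Poisson kernel; the identity turns the real part
  of a Cauchy transform into a Poisson integral.
\<close>

lemma poisson_eq_Re:
  assumes "cmod w < 1"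
  shows "2 * Re (1 / (1 - w)) - 1 = (1 - (cmod w)\<^sup>2) / (cmod (1 - w))\<^sup>2"
proof -
  have ne: "1 - w \<noteq> 0" using assms by auto
  then have n: "(cmod (1 - w))\<^sup>2 \<noteq> 0" by simp
  have sq: "(cmod (1 - w))\<^sup>2 = 1 - 2 * Re w + (cmod w)\<^sup>2"
    by (simp add: cmod_power2) (simp add: power2_eq_square algebra_simps)
  have r: "Re (1 / (1 - w)) = Re (1 - w) / (cmod (1 - w))\<^sup>2"
    by (simp add: Re_divide cmod_power2)
  show ?thesis unfolding r using n
    by (simp add: divide_simps) (simp add: sq)
qed

lemma one_minus_rcis_pos:
  assumes "0 \<le> r" "r < 1"
  shows "0 < 1 - r" "1 - r \<le> cmod (1 - of_real r * cis s)"
  using assms norm_triangle_ineq2[of 1 "of_real r * cis s"] by (auto simp: norm_mult)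

lemma poisson_nonneg: "0 \<le> r \<Longrightarrow> r < 1 \<Longrightarrow> 0 \<le> poisson r s"
  unfolding poisson_def by (intro divide_nonneg_nonneg) (auto simp: power_le_one)

lemma poisson_le:
  assumes "0 \<le> r" "r < 1"
  shows "poisson r s \<le> 1 / (1 - r)\<^sup>2"
proof -
  have "poisson r s \<le> 1 / (cmod (1 - of_real r * cis (2 * pi * s)))\<^sup>2"
    unfolding poisson_def using assms by (intro divide_right_mono) auto
  also have "\<dots> \<le> 1 / (1 - r)\<^sup>2"
    using one_minus_rcis_pos(1)[OF assms] one_minus_rcis_pos(2)[OF assms, of "2 * pi * s"]
    by (intro divide_left_mono power_mono mult_pos_pos zero_less_power) auto
  finally show ?thesis .
qed

lemma poisson_measurable [measurable]: "poisson r \<in> borel_measurable borel"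
  unfolding poisson_def
  by (intro borel_measurable_divide borel_measurable_const borel_measurable_continuous_onI continuous_intros)

text \<open>
  The kernel is \<open>1 - r\<^sup>2\<close> times the squared modulus of a geometric series, and by Parseval that squared
  modulus has as mean the sum of all powers of \<open>r\<^sup>2\<close>, which is \<open>1 / (1 - r\<^sup>2)\<close>.
\<close>

lemma integral_poisson:
  assumes r: "0 \<le> r" "r < 1"
  shows "(\<integral>t. poisson r (t - y) \<partial>unif01) = 1"
proof -
  define c where "c = (\<lambda>n. (of_real r * cis (- 2 * pi * y)) ^ n)"
  have nc: "cmod (c n) = r ^ n" for n using r by (simp add: c_def norm_power norm_mult)
  have sum: "(\<Sum>n. c n * cis (2 * pi * t) ^ n) = 1 / (1 - of_real r * cis (2 * pi * (t - y)))" for t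
  proof -
    have "cis (- 2 * pi * y) * cis (2 * pi * t) = cis (2 * pi * (t - y))"
      by (simp add: cis_mult algebra_simps)
    then have "c n * cis (2 * pi * t) ^ n = (of_real r * cis (2 * pi * (t - y))) ^ n" for n
      unfolding c_def power_mult_distrib[symmetric] by (simp only: mult.assoc)
    then have "(\<Sum>n. c n * cis (2 * pi * t) ^ n) = (\<Sum>n. (of_real r * cis (2 * pi * (t - y))) ^ n)"
      by simp
    also have "\<dots> = 1 / (1 - of_real r * cis (2 * pi * (t - y)))"
      by (rule suminf_geometric) (use r in \<open>simp add: norm_mult\<close>)
    finally show ?thesis .
  qed
  have r2: "r\<^sup>2 < 1" using r by (simp add: power_less_one_iff abs_square_less_1)
  have sq: "(r ^ n)\<^sup>2 = (r\<^sup>2) ^ n" for n by (simp add: power_mult[symmetric] mult.commute)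
  have "(\<lambda>n. (cmod (c n))\<^sup>2) sums (\<integral>t. (cmod (\<Sum>n. c n * cis (2 * pi * t) ^ n))\<^sup>2 \<partial>unif01)"
    by (rule parseval_absolutely_summable(2)) (use r in \<open>simp add: nc\<close>)
  moreover have "(\<lambda>n. (cmod (c n))\<^sup>2) sums (1 / (1 - r\<^sup>2))"
    using geometric_sums[of "r\<^sup>2"] r2 by (simp add: nc sq)
  ultimately have "(\<integral>t. (cmod (1 / (1 - of_real r * cis (2 * pi * (t - y)))))\<^sup>2 \<partial>unif01) = 1 / (1 - r\<^sup>2)"
    by (simp add: sum sums_iff)
  moreover have "poisson r (t - y) = (1 - r\<^sup>2) * (cmod (1 / (1 - of_real r * cis (2 * pi * (t - y)))))\<^sup>2" for t
    by (simp add: poisson_def norm_divide power_divide)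
  ultimately show ?thesis using r2 by simp
qed

text \<open>
  By compactness the points of \<open>K\<close> keep a positive distance from \<open>t\<close> on the circle. The denominator of
  the kernel is thus bounded below on \<open>K\<close>, uniformly in \<open>r\<close>, while its numerator tends to \<open>0\<close>.
\<close>

lemma poisson_tendsto_0:
  assumes r: "\<And>j. 0 \<le> r j" "\<And>j. r j < 1" "r \<longlonglongrightarrow> 1"
    and K: "compact K" and fin: "finite_measure \<nu>" and sets: "sets \<nu> = sets borel"
    and t: "\<And>y. y \<in> K \<Longrightarrow> cis (2 * pi * (t - y)) \<noteq> 1"
  shows "(\<lambda>j. \<integral>y. indicator K y * poisson (r j) (t - y) \<partial>\<nu>) \<longlonglongrightarrow> 0"
proof -
  interpret finite_measure \<nu> by fact
  have [measurable_cong]: "sets \<nu> = sets borel" by fact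
  have [measurable]: "K \<in> sets borel" using K by (simp add: borel_compact)
  obtain d where d: "d > 0" "\<And>y. y \<in> K \<Longrightarrow> d \<le> cmod (1 - cis (2 * pi * (t - y)))"
  proof (cases "K = {}")
    case False
    have "continuous_on K (\<lambda>y. cmod (1 - cis (2 * pi * (t - y))))" by (intro continuous_intros)
    from continuous_attains_inf[OF K False this] obtain y0 where
      "y0 \<in> K" "\<And>y. y \<in> K \<Longrightarrow> cmod (1 - cis (2 * pi * (t - y0))) \<le> cmod (1 - cis (2 * pi * (t - y)))"
      by blast
    with t show ?thesis by (intro that[of "cmod (1 - cis (2 * pi * (t - y0)))"]) force+
  qed (auto intro: that[of 1])
  have bd: "indicator K y * poisson (r j) (t - y) \<le> (1 - (r j)\<^sup>2) * (4 / d\<^sup>2)" for y j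
  proof (cases "y \<in> K")
    case True
    define u where "u = cis (2 * pi * (t - y))"
    \<comment> \<open>Shrinking \<open>u\<close> towards \<open>0\<close> costs at most a factor \<open>2\<close>:
      \<open>\<bar>1 - u\<bar> \<le> \<bar>1 - r u\<bar> + (1 - r)\<close> and \<open>1 - r \<le> \<bar>1 - r u\<bar>\<close>.\<close>
    have "cmod (1 - u) \<le> cmod (1 - of_real (r j) * u) + cmod (of_real (r j) * u - u)"
      using norm_triangle_ineq[of "1 - of_real (r j) * u" "of_real (r j) * u - u"] by simp
    also have "of_real (r j) * u - u = of_real (r j - 1) * u" by (simp add: algebra_simps)
    also have "cmod \<dots> = 1 - r j" using r(2)[of j] unfolding norm_mult norm_of_real by (simp add: u_def)
    also have "1 - r j \<le> cmod (1 - of_real (r j) * u)"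
      using one_minus_rcis_pos(2)[OF r(1,2)] by (simp add: u_def)
    finally have "d / 2 \<le> cmod (1 - of_real (r j) * u)" using d(2)[OF True] by (simp add: u_def)
    then have "(d / 2)\<^sup>2 \<le> (cmod (1 - of_real (r j) * u))\<^sup>2" using d(1) by (intro power_mono) auto
    moreover have "0 < (d / 2)\<^sup>2" using d(1) by simp
    ultimately have "poisson (r j) (t - y) \<le> (1 - (r j)\<^sup>2) / (d / 2)\<^sup>2"
      unfolding poisson_def u_def[symmetric] using r(1,2)[of j]
      by (intro divide_left_mono mult_pos_pos) (auto simp: power_le_one intro: less_le_trans)
    then show ?thesis using True by (simp add: power_divide)
  next
    case False
    then show ?thesis using r(1,2)[of j] by (simp add: power_le_one)
  qed
  have lb: "0 \<le> indicator K y * poisson (r j) (t - y)" for y j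
    using poisson_nonneg[OF r(1,2)] by simp
  have int: "integrable \<nu> (\<lambda>y. indicator K y * poisson (r j) (t - y))" for j
    by (rule integrable_const_bound[where B="(1 - (r j)\<^sup>2) * (4 / d\<^sup>2)"]) (use bd lb in auto)
  have "(\<lambda>j. (1 - (r j)\<^sup>2) * (4 / d\<^sup>2) * measure \<nu> (space \<nu>)) \<longlonglongrightarrow> (1 - 1\<^sup>2) * (4 / d\<^sup>2) * measure \<nu> (space \<nu>)"
    by (intro tendsto_intros r(3))
  then have lim: "(\<lambda>j. (1 - (r j)\<^sup>2) * (4 / d\<^sup>2) * measure \<nu> (space \<nu>)) \<longlonglongrightarrow> 0" by simp
  show ?thesis
  proof (rule tendsto_sandwich[OF _ _ tendsto_const lim])
    show "\<forall>\<^sub>F j in sequentially. 0 \<le> (\<integral>y. indicator K y * poisson (r j) (t - y) \<partial>\<nu>)"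
      using lb by (intro always_eventually allI integral_nonneg_AE) auto
    show "\<forall>\<^sub>F j in sequentially. (\<integral>y. indicator K y * poisson (r j) (t - y) \<partial>\<nu>)
        \<le> (1 - (r j)\<^sup>2) * (4 / d\<^sup>2) * measure \<nu> (space \<nu>)"
    proof (intro always_eventually allI)
      fix j
      have "(\<integral>y. indicator K y * poisson (r j) (t - y) \<partial>\<nu>) \<le> (\<integral>y. (1 - (r j)\<^sup>2) * (4 / d\<^sup>2) \<partial>\<nu>)"
        by (intro integral_mono int bd) auto
      then show "(\<integral>y. indicator K y * poisson (r j) (t - y) \<partial>\<nu>)
        \<le> (1 - (r j)\<^sup>2) * (4 / d\<^sup>2) * measure \<nu> (space \<nu>)" by (simp add: mult.commute)
    qed
  qed
qed

section \<open>Singular measures and inner functions\<close>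

lemma cauchy_transform_sums:
  assumes "prob_space \<nu>" and "sets \<nu> = sets borel" and w: "cmod w < 1"
  defines "m \<equiv> \<lambda>n. \<integral>y. cis (- 2 * pi * y) ^ n \<partial>\<nu>"
  shows "(\<lambda>n. m n * w ^ n) sums (\<integral>y. 1 / (1 - w * cis (- 2 * pi * y)) \<partial>\<nu>)"
proof -
  interpret prob_space \<nu> by fact
  have [measurable_cong]: "sets \<nu> = sets borel" by fact
  define f where "f = (\<lambda>n y. (w * cis (- 2 * pi * y)) ^ n)"
  have [measurable]: "f n \<in> borel_measurable \<nu>" for n
    unfolding f_def by (subst measurable_cong_sets[OF assms(2) refl])
      (intro borel_measurable_continuous_onI continuous_intros)
  have nf: "norm (f n y) = cmod w ^ n" for n y by (simp add: f_def norm_power norm_mult)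
  have int: "integrable \<nu> (f n)" for n
    by (rule integrable_const_bound[where B="cmod w ^ n"]) (simp_all add: nf)
  have "(\<lambda>n. integral\<^sup>L \<nu> (f n)) sums (\<integral>y. (\<Sum>n. f n y) \<partial>\<nu>)"
    by (rule sums_integral[OF int]) (use w prob_space in \<open>simp_all add: nf\<close>)
  also have "(\<lambda>y. \<Sum>n. f n y) = (\<lambda>y. 1 / (1 - w * cis (- 2 * pi * y)))"
    unfolding f_def using w by (intro ext suminf_geometric) (simp add: norm_mult)
  also have "(\<lambda>n. integral\<^sup>L \<nu> (f n)) = (\<lambda>n. m n * w ^ n)"
    by (simp add: f_def m_def power_mult_distrib mult.commute)
  finally show ?thesis .
qed

text \<open>
  Let \<open>M\<close> and \<open>b\<close> be the power series with coefficients \<open>m\<close> and \<open>a\<close>. The convolution identity says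
  \<open>b M = M - 1\<close>, that is \<open>b = 1 - 1 / M\<close>. As \<open>M\<close> is a Cauchy transform, \<open>2 Re M - 1\<close> is the Poisson
  integral \<open>P\<close> of \<open>\<nu>\<close>. Hence \<open>1 - \<bar>b\<bar>\<^sup>2 = P / \<bar>M\<bar>\<^sup>2\<close>, and \<open>\<bar>M\<bar> \<ge> Re M \<ge> 1/2\<close> because \<open>P \<ge> 0\<close>.
\<close>

lemma inner_function_defect_le_poisson:
  assumes "prob_space \<nu>" and "sets \<nu> = sets borel" and r: "0 \<le> r" "r < 1"
  defines "m \<equiv> \<lambda>n. \<integral>y. cis (- 2 * pi * y) ^ n \<partial>\<nu>"
  assumes a: "a 0 = 0" "\<And>n. n > 0 \<Longrightarrow> (\<Sum>i\<le>n. a i * m (n - i)) = m n" "\<And>n. cmod (a n) \<le> 1"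
  shows "1 - (cmod (\<Sum>n. a n * of_real (r ^ n) * cis (2 * pi * t) ^ n))\<^sup>2
    \<le> 4 * (\<integral>y. poisson r (t - y) \<partial>\<nu>)"
proof -
  interpret prob_space \<nu> by fact
  have [measurable_cong]: "sets \<nu> = sets borel" by fact
  define w where "w = of_real r * cis (2 * pi * t)"
  have nw: "cmod w = r" using r by (simp add: w_def norm_mult)
  define M where "M = (\<integral>y. 1 / (1 - w * cis (- 2 * pi * y)) \<partial>\<nu>)"
  have M: "(\<lambda>n. m n * w ^ n) sums M"
    unfolding M_def m_def by (rule cauchy_transform_sums) (use assms nw in auto)
  have m0: "m 0 = 1" using prob_space by (simp add: m_def)
  have nm: "cmod (m n) \<le> 1" for n
  proof -
    have "cmod (m n) \<le> (\<integral>y. cmod (cis (- 2 * pi * y) ^ n) \<partial>\<nu>)"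
      unfolding m_def by (rule integral_norm_bound)
    then show ?thesis using prob_space by (simp add: norm_power)
  qed
  have summ: "summable (\<lambda>n. cmod (c n * w ^ n))" if "\<And>n. cmod (c n) \<le> 1" for c :: "nat \<Rightarrow> complex"
  proof (rule summable_comparison_test')
    show "summable (\<lambda>n. r ^ n)" using r by simp
    show "norm (cmod (c n * w ^ n)) \<le> r ^ n" if "n \<ge> 0" for n
      using mult_right_mono[OF \<open>cmod (c n) \<le> 1\<close>, of "r ^ n"] r by (simp add: norm_mult norm_power nw)
  qed
  define b where "b = (\<Sum>n. a n * w ^ n)"
  have Mne: "M = (\<Sum>n. m n * w ^ n)" using M by (simp add: sums_iff)
  have "(\<lambda>k. \<Sum>i\<le>k. (a i * w ^ i) * (m (k - i) * w ^ (k - i))) sums (b * M)"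
    unfolding Mne b_def by (rule Cauchy_product_sums) (use a nm summ in auto)
  moreover have "(\<Sum>i\<le>k. (a i * w ^ i) * (m (k - i) * w ^ (k - i))) = m k * w ^ k - (if k = 0 then 1 else 0)" for k
  proof -
    have "(\<Sum>i\<le>k. (a i * w ^ i) * (m (k - i) * w ^ (k - i))) = (\<Sum>i\<le>k. a i * m (k - i)) * w ^ k"
      unfolding sum_distrib_right
    proof (rule sum.cong)
      fix i assume "i \<in> {..k}"
      then have "w ^ i * w ^ (k - i) = w ^ k" by (simp add: power_add[symmetric])
      then show "a i * w ^ i * (m (k - i) * w ^ (k - i)) = a i * m (k - i) * w ^ k"
        by (metis mult.assoc mult.left_commute)
    qed simp
    then show ?thesis using a m0 by (cases "k = 0") simp_all
  qed
  moreover have "(\<lambda>k. m k * w ^ k - (if k = 0 then 1 else 0)) sums (M - 1)"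
    by (intro sums_diff M sums_single[of 0 "\<lambda>_. 1::complex", simplified])
  ultimately have bM: "b * M = M - 1" by (simp add: sums_iff)
  define P where "P = (\<integral>y. poisson r (t - y) \<partial>\<nu>)"
  have P0: "0 \<le> P" unfolding P_def using poisson_nonneg[OF r] by simp
  have ReM: "2 * Re M - 1 = P"
  proof -
    have pos: "1 - r \<le> cmod (1 - w * cis (- 2 * pi * y))" "1 - r > 0" for y
    proof -
      have "w * cis (- 2 * pi * y) = of_real r * cis (2 * pi * (t - y))"
        by (simp add: w_def cis_mult mult.assoc algebra_simps)
      then show "1 - r \<le> cmod (1 - w * cis (- 2 * pi * y))"  "1 - r > 0"
        using one_minus_rcis_pos[OF r] by auto
    qed
    have [measurable]: "(\<lambda>y. 1 / (1 - w * cis (- 2 * pi * y))) \<in> borel_measurable borel"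
      by (intro borel_measurable_divide borel_measurable_const borel_measurable_continuous_onI continuous_intros)
    have int: "integrable \<nu> (\<lambda>y. 1 / (1 - w * cis (- 2 * pi * y)))"
    proof (rule integrable_const_bound[where B="1 / (1 - r)"])
      show "AE y in \<nu>. cmod (1 / (1 - w * cis (- 2 * pi * y))) \<le> 1 / (1 - r)"
        unfolding norm_divide norm_one using pos by (intro AE_I2 frac_le) auto
    qed measurable
    have "P = (\<integral>y. 2 * Re (1 / (1 - w * cis (- 2 * pi * y))) - 1 \<partial>\<nu>)"
      unfolding P_def
    proof (rule Bochner_Integration.integral_cong[OF refl])
      fix y
      have eq: "w * cis (- 2 * pi * y) = of_real r * cis (2 * pi * (t - y))"
        by (simp add: w_def cis_mult mult.assoc algebra_simps)
      show "poisson r (t - y) = 2 * Re (1 / (1 - w * cis (- 2 * pi * y))) - 1"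
        unfolding eq by (subst poisson_eq_Re) (use r in \<open>auto simp: norm_mult poisson_def\<close>)
    qed
    also have "\<dots> = 2 * Re M - 1"
      unfolding M_def using int prob_space integral_Re[OF int] integrable_Re[OF int]
      by (subst Bochner_Integration.integral_diff) auto
    finally show ?thesis by simp
  qed
  have half: "1 / 2 \<le> cmod M" using complex_Re_le_cmod[of M] ReM P0 by linarith
  then have M0: "M \<noteq> 0" by auto
  have "(cmod M)\<^sup>2 * (1 - (cmod b)\<^sup>2) = (cmod M)\<^sup>2 - (cmod (b * M))\<^sup>2"
    by (simp add: norm_mult power_mult_distrib algebra_simps)
  also have "\<dots> = P"
    unfolding bM ReM[symmetric] by (simp add: cmod_power2) (simp add: power2_eq_square algebra_simps)
  finally have eq: "1 - (cmod b)\<^sup>2 = P / (cmod M)\<^sup>2" using M0 by (simp add: field_simps)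
  have "(1 / 2)\<^sup>2 \<le> (cmod M)\<^sup>2" using half by (intro power_mono) auto
  then have "P / (cmod M)\<^sup>2 \<le> P / (1 / 2)\<^sup>2"
    using P0 M0 by (intro divide_left_mono mult_pos_pos) auto
  then have "1 - (cmod b)\<^sup>2 \<le> 4 * P" unfolding eq by (simp add: power_divide)
  moreover have "(\<lambda>n. a n * of_real (r ^ n) * cis (2 * pi * t) ^ n) = (\<lambda>n. a n * w ^ n)"
    by (simp add: w_def power_mult_distrib mult.assoc)
  ultimately show ?thesis by (simp only: b_def P_def)
qed

text \<open>
  The function \<open>b\<close> with Taylor coefficients \<open>a\<close> is inner. On the circle of radius \<open>r\<close>,
  \<open>1 - \<bar>b\<bar>\<^sup>2\<close> is at most \<open>min 1 (4 P)\<close>. Choose a compact null set \<open>K\<close> that carries \<open>\<nu>\<close> up to a small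
  \<open>\<epsilon>\<close> and split \<open>P\<close> accordingly. The part from \<open>K\<close> tends to \<open>0\<close> almost everywhere as \<open>r\<close> tends to
  \<open>1\<close>, and, cut off at \<open>1\<close>, also in the mean; the rest has mean at most \<open>\<epsilon>\<close> by Fubini, whatever \<open>r\<close>
  is. So the mean of \<open>\<bar>b\<bar>\<^sup>2\<close>, which by Parseval is at most the sum of the \<open>\<bar>a n\<bar>\<^sup>2\<close>, comes arbitrarily close to \<open>1\<close>; the sum
  itself is at most \<open>1\<close> by \<open>bessel\<close>.
\<close>

lemma inner_function_of_singular_measure:
  fixes a :: "nat \<Rightarrow> complex"
  assumes "prob_space \<nu>" and "sets \<nu> = sets borel"
    and N: "N \<in> sets borel" "N \<subseteq> {0..<1}" "emeasure lborel N = 0" "emeasure \<nu> (UNIV - N) = 0"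
  defines "m \<equiv> \<lambda>n. \<integral>y. cis (- 2 * pi * y) ^ n \<partial>\<nu>"
  assumes a: "a 0 = 0" "\<And>n. n > 0 \<Longrightarrow> (\<Sum>i\<le>n. a i * m (n - i)) = m n"
    and bessel: "\<And>n. (\<Sum>i<n. (cmod (a i))\<^sup>2) \<le> 1"
  shows "(\<lambda>n. (cmod (a n))\<^sup>2) sums 1"
proof -
  interpret prob_space \<nu> by fact
  have [measurable_cong]: "sets \<nu> = sets borel" by fact
  have space[simp]: "space \<nu> = UNIV" using sets_eq_imp_space_eq[OF assms(2)] by simp
  interpret pair: pair_prob_space unif01 \<nu> ..
  have a1: "cmod (a n) \<le> 1" for n
  proof -
    have "(cmod (a n))\<^sup>2 \<le> (\<Sum>i<Suc n. (cmod (a i))\<^sup>2)" by (simp add: sum_nonneg)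
    with bessel[of "Suc n"] have "(cmod (a n))\<^sup>2 \<le> 1\<^sup>2" by simp
    then show ?thesis by (rule power2_le_imp_le) simp
  qed
  have summ: "summable (\<lambda>n. (cmod (a n))\<^sup>2)"
    by (rule summableI_nonneg_bounded[OF _ bessel]) simp
  define s where "s = (\<Sum>n. (cmod (a n))\<^sup>2)"
  have "s \<le> 1" unfolding s_def by (rule suminf_le_const[OF summ bessel])
  moreover have "1 \<le> s"
  proof (rule field_le_epsilon)
    fix \<epsilon> :: real assume \<epsilon>: "\<epsilon> > 0"
    \<comment> \<open>\<open>\<epsilon> / 4\<close> makes up for the factor \<open>4\<close> in \<open>1 - \<bar>b\<bar>\<^sup>2 \<le> 4 P\<close>.\<close>
    obtain K where K: "compact K" "K \<subseteq> N" "measure \<nu> (UNIV - K) < \<epsilon> / 4"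
    proof -
      have N1: "emeasure \<nu> N = 1"
        using emeasure_space_1 N(4) emeasure_Diff[of \<nu> "UNIV - N" UNIV] N(1) by (simp add: Diff_Diff_Int)
      have "emeasure \<nu> N = (SUP K \<in> {K. K \<subseteq> N \<and> compact K}. emeasure \<nu> K)"
        by (rule inner_regular) (use assms emeasure_finite in auto)
      moreover have "ennreal (1 - \<epsilon> / 4) < 1" using \<epsilon> by (simp add: ennreal_less_one_iff)
      ultimately have "ennreal (1 - \<epsilon> / 4) < (SUP K \<in> {K. K \<subseteq> N \<and> compact K}. emeasure \<nu> K)"
        unfolding N1 by simp
      then obtain K where K: "K \<subseteq> N" "compact K" "ennreal (1 - \<epsilon> / 4) < emeasure \<nu> K"
        by (auto simp: less_SUP_iff)
      then have "1 - \<epsilon> / 4 < measure \<nu> K"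
        by (cases "0 \<le> 1 - \<epsilon> / 4") (auto simp: emeasure_eq_measure ennreal_less_iff intro: less_le_trans[OF _ measure_nonneg])
      moreover have "K \<in> sets \<nu>" using K(2) assms(2) by (simp add: borel_compact)
      ultimately show ?thesis using K that[of K] prob_compl[of K] by simp
    qed
    have [measurable]: "K \<in> sets borel" using K(1) by (simp add: borel_compact)
    define r where "r = (\<lambda>j. real j / (real j + 1))"
    have r: "0 \<le> r j" "r j < 1" for j by (auto simp: r_def)
    have rlim: "r \<longlonglongrightarrow> 1" unfolding r_def by real_asymp
    define PK where "PK = (\<lambda>j t. \<integral>y. indicator K y * poisson (r j) (t - y) \<partial>\<nu>)"
    define PC where "PC = (\<lambda>j t. \<integral>y. indicator (UNIV - K) y * poisson (r j) (t - y) \<partial>\<nu>)"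
    define F where "F = (\<lambda>j t. \<Sum>n. a n * of_real (r j ^ n) * cis (2 * pi * t) ^ n)"
    have bounded_poisson: "\<bar>indicator A y * poisson (r j) (t - y)\<bar> \<le> 1 / (1 - r j)\<^sup>2" for A t y j
      using poisson_nonneg[OF r] poisson_le[OF r] by (auto simp: indicator_def)
    have int_poisson: "integrable \<nu> (\<lambda>y. indicator A y * poisson (r j) (t - y))"
      if [measurable]: "A \<in> sets borel" for A j t
      by (rule integrable_const_bound[where B="1 / (1 - r j)\<^sup>2"]) (use bounded_poisson in auto)
    have [measurable]: "PK j \<in> borel_measurable borel" "PC j \<in> borel_measurable borel" for j
      unfolding PK_def PC_def by measurable
    have PC_eq: "integrable unif01 (PC j)" "(\<integral>t. PC j t \<partial>unif01) = measure \<nu> (UNIV - K)" for j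
    proof -
      have int: "integrable (unif01 \<Otimes>\<^sub>M \<nu>) (\<lambda>(t, y). indicator (UNIV - K) y * poisson (r j) (t - y))"
        by (rule pair.P.integrable_const_bound[where B="1 / (1 - r j)\<^sup>2"]) (use bounded_poisson in auto)
      show "integrable unif01 (PC j)" unfolding PC_def using pair.integrable_fst'[OF int] by simp
      have "(\<integral>t. PC j t \<partial>unif01) = (\<integral>y. (\<integral>t. indicator (UNIV - K) y * poisson (r j) (t - y) \<partial>unif01) \<partial>\<nu>)"
        unfolding PC_def by (rule pair.Fubini_integral[OF int, symmetric])
      also have "\<dots> = measure \<nu> (UNIV - K)" by (simp add: integral_poisson[OF r])
      finally show "(\<integral>t. PC j t \<partial>unif01) = measure \<nu> (UNIV - K)" .
    qed
    have PK0: "0 \<le> PK j t" "0 \<le> PC j t" for j t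
      unfolding PK_def PC_def by (intro integral_nonneg_AE AE_I2 mult_nonneg_nonneg poisson_nonneg r; simp)+
    have min_int: "integrable unif01 (\<lambda>t. min 1 (4 * PK j t))" for j
      by (rule unif01.integrable_const_bound[where B=1]) (use PK0 in auto)
    have parseval: "integrable unif01 (\<lambda>t. (cmod (F j t))\<^sup>2)"
      "(\<lambda>n. (cmod (a n))\<^sup>2 * (r j ^ n)\<^sup>2) sums (\<integral>t. (cmod (F j t))\<^sup>2 \<partial>unif01)" for j
    proof -
      have "summable (\<lambda>n. cmod (a n * of_real (r j ^ n)))"
      proof (rule summable_comparison_test')
        show "summable (\<lambda>n. r j ^ n)" using r by simp
        show "norm (cmod (a n * of_real (r j ^ n))) \<le> r j ^ n" for n
          using mult_right_mono[OF a1, of "r j ^ n" n] r(1)[of j] by (simp add: norm_mult norm_power)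
      qed
      from parseval_absolutely_summable[OF this]
      show "integrable unif01 (\<lambda>t. (cmod (F j t))\<^sup>2)"
        "(\<lambda>n. (cmod (a n))\<^sup>2 * (r j ^ n)\<^sup>2) sums (\<integral>t. (cmod (F j t))\<^sup>2 \<partial>unif01)"
        using r(1) by (simp_all add: F_def norm_mult norm_power power_mult_distrib)
    qed
    have int_F: "(\<integral>t. (cmod (F j t))\<^sup>2 \<partial>unif01) \<le> s" for j
      unfolding s_def
    proof (rule sums_le[OF _ parseval(2) summable_sums[OF summ]])
      show "(cmod (a n))\<^sup>2 * (r j ^ n)\<^sup>2 \<le> (cmod (a n))\<^sup>2" for n
        using r[of j] by (intro mult_right_le_one_le) (auto simp: power_le_one)
    qed
    have defect: "1 - (cmod (F j t))\<^sup>2 \<le> min 1 (4 * PK j t) + 4 * PC j t" for j t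
    proof -
      have "(\<integral>y. poisson (r j) (t - y) \<partial>\<nu>) = PK j t + PC j t"
        unfolding PK_def PC_def
        by (subst Bochner_Integration.integral_add[symmetric])
           (auto intro!: int_poisson Bochner_Integration.integral_cong split: split_indicator)
      moreover have "1 - (cmod (F j t))\<^sup>2 \<le> 4 * (\<integral>y. poisson (r j) (t - y) \<partial>\<nu>)"
        unfolding F_def
        by (rule inner_function_defect_le_poisson) (use assms(1,2) r a a1 in \<open>auto simp: m_def\<close>)
      ultimately show ?thesis using PK0(1)[of j t] PK0(2)[of j t] zero_le_power2[of "cmod (F j t)"]
        unfolding min_def by (split if_split) linarith
    qed
    have step: "1 - s \<le> (\<integral>t. min 1 (4 * PK j t) \<partial>unif01) + 4 * measure \<nu> (UNIV - K)" for j
    proof -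
      have "1 - s \<le> 1 - (\<integral>t. (cmod (F j t))\<^sup>2 \<partial>unif01)" using int_F[of j] by simp
      also have "\<dots> = (\<integral>t. 1 - (cmod (F j t))\<^sup>2 \<partial>unif01)"
        using parseval(1) unif01.prob_space by simp
      also have "\<dots> \<le> (\<integral>t. min 1 (4 * PK j t) + 4 * PC j t \<partial>unif01)"
        by (rule integral_mono) (use parseval(1) min_int PC_eq defect in auto)
      also have "\<dots> = (\<integral>t. min 1 (4 * PK j t) \<partial>unif01) + 4 * measure \<nu> (UNIV - K)"
        using min_int PC_eq by simp
      finally show ?thesis .
    qed
    have "(\<lambda>j. \<integral>t. min 1 (4 * PK j t) \<partial>unif01) \<longlonglongrightarrow> (\<integral>t. 0 \<partial>unif01)"
    proof (rule integral_dominated_convergence[where w = "\<lambda>_. 1"])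
      have "emeasure lborel K = 0"
        using emeasure_mono[of K N lborel] K N by simp
      then have "K \<in> null_sets lborel" by (auto simp: null_sets_def)
      \<comment> \<open>The endpoints are discarded since \<open>0\<close> and \<open>1\<close> are the same point of the circle: for \<open>t\<close> strictly
        between them and \<open>y\<close> in \<open>[0,1)\<close>, equality on the circle means \<open>t = y\<close>.\<close>
      then have "AE t in lborel. t \<notin> K" "AE t in lborel. t \<noteq> (0::real)" "AE t in lborel. t \<noteq> (1::real)"
        by (auto intro: AE_not_in AE_lborel_singleton)
      then have "AE t in lborel. ennreal (indicator {0..1} t) > 0 \<longrightarrow> t \<in> {0<..<1} - K"
      proof eventually_elim
        case (elim t)
        then show ?case by (auto simp: indicator_def)
      qed
      then have "AE t in unif01. t \<in> {0<..<1} - K"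
        unfolding unif01_def by (subst AE_density) auto
      then show "AE t in unif01. (\<lambda>j. min 1 (4 * PK j t)) \<longlonglongrightarrow> 0"
      proof eventually_elim
        case (elim t)
        have "(\<lambda>j. PK j t) \<longlonglongrightarrow> 0"
          unfolding PK_def
        proof (rule poisson_tendsto_0[OF r rlim K(1) _ assms(2)])
          show "finite_measure \<nu>" by (rule finite_measure_axioms)
          fix y assume y: "y \<in> K"
          show "cis (2 * pi * (t - y)) \<noteq> 1"
          proof
            assume "cis (2 * pi * (t - y)) = 1"
            then have "cos (2 * pi * (t - y)) = 1" by (metis Re_complex_of_real cis.simps(1) of_real_1)
            then obtain n :: int where "2 * pi * (t - y) = of_int n * 2 * pi"
              by (auto simp: cos_one_2pi_int)
            then have "t - y = of_int n" by simp
            moreover have "-1 < t - y" "t - y < 1" using elim y K(2) N(2) by auto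
            ultimately have "n = 0" by linarith
            with \<open>t - y = of_int n\<close> elim y show False by auto
          qed
        qed
        then have "(\<lambda>j. min 1 (4 * PK j t)) \<longlonglongrightarrow> min 1 (4 * 0)" by (intro tendsto_intros)
        then show ?case by simp
      qed
      show "AE t in unif01. norm (min 1 (4 * PK j t)) \<le> 1" for j
        using PK0 by (intro AE_I2) auto
    qed auto
    then have "(\<lambda>j. (\<integral>t. min 1 (4 * PK j t) \<partial>unif01) + 4 * measure \<nu> (UNIV - K)) \<longlonglongrightarrow> 0 + 4 * measure \<nu> (UNIV - K)"
      by (intro tendsto_add tendsto_const) simp
    then have "1 - s \<le> 0 + 4 * measure \<nu> (UNIV - K)"
      by (rule LIMSEQ_le_const) (use step in auto)
    with K(3) show "1 \<le> s + \<epsilon>" by simp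
  qed
  ultimately have "s = 1" by simp
  with summable_sums[OF summ] show ?thesis by (simp add: s_def)
qed

section \<open>Complex inner product spaces\<close>

lemma scaleC_module: "Modules.module (scaleC :: complex \<Rightarrow> 'h::complex_inner \<Rightarrow> 'h)"
proof
  show "scaleC 1 x = x" for x :: 'h using scaleR_scaleC[of 1 x] by simp
qed (simp_all add: scaleC_add_right scaleC_add_left scaleC_scaleC)

interpretation scaleC: Modules.module "scaleC :: complex \<Rightarrow> 'h::complex_inner \<Rightarrow> 'h"
  by (rule scaleC_module)

lemma cinner_add_right: "cinner z (x + y) = cinner z x + cinner z (y::'h::complex_inner)"
  by (metis cinner_add_left cinner_commute complex_cnj_add)

lemma cinner_scaleC_right: "cinner x (scaleC c y) = cnj c * cinner x (y::'h::complex_inner)"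
  by (metis cinner_scaleC_left cinner_commute complex_cnj_mult)

lemma cinner_zero [simp]: "cinner 0 x = 0" "cinner x (0::'h::complex_inner) = 0"
  using cinner_add_left[of 0 0 x] cinner_add_right[of x 0 0] by simp_all

lemma cinner_diff_left: "cinner (x - y) z = cinner x z - cinner (y::'h::complex_inner) z"
  using cinner_add_left[of "x - y" y z] by simp

lemma cinner_diff_right: "cinner z (x - y) = cinner z x - cinner z (y::'h::complex_inner)"
  using cinner_add_right[of z "x - y" y] by simp

lemma cinner_sum_left: "cinner (sum f I) z = (\<Sum>i\<in>I. cinner (f i) (z::'h::complex_inner))"
  by (induction I rule: infinite_finite_induct) (simp_all add: cinner_add_left)

lemma cinner_self: "cinner x x = of_real ((norm (x::'h::complex_inner))\<^sup>2)"
proof -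
  have "Im (cinner x x) = 0" using cinner_commute[of x x] by (metis complex_cnj Im_complex_of_real complex_eq_iff cnj.sel(2) neg_equal_zero)
  then show ?thesis using cinner_ge_zero[of x] by (simp add: norm_eq_sqrt_cinner complex_eq_iff)
qed

lemma norm_sq_eq_cinner: "(norm (x::'h::complex_inner))\<^sup>2 = Re (cinner x x)"
  by (simp add: cinner_self)

lemma norm_scaleC: "norm (scaleC c (x::'h::complex_inner)) = cmod c * norm x"
proof -
  have "(norm (scaleC c x))\<^sup>2 = (cmod c * norm x)\<^sup>2"
  proof -
    have "cinner (scaleC c x) (scaleC c x) = of_real ((cmod c)\<^sup>2) * cinner x x"
      unfolding cinner_scaleC_left cinner_scaleC_right complex_norm_square by (simp add: mult.assoc)
    then show ?thesis unfolding norm_sq_eq_cinner power_mult_distrib by (simp del: of_real_power)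
  qed
  then show ?thesis by simp
qed

lemma tendsto_scaleC_zero:
  fixes f :: "'a \<Rightarrow> 'h::complex_inner"
  assumes "(f \<longlongrightarrow> 0) F"
  shows "((\<lambda>x. scaleC c (f x)) \<longlongrightarrow> 0) F"
proof (rule tendsto_norm_zero_cancel)
  show "((\<lambda>x. norm (scaleC c (f x))) \<longlongrightarrow> 0) F"
    unfolding norm_scaleC by (intro tendsto_mult_right_zero tendsto_norm_zero assms)
qed

section \<open>Iterated rejections\<close>

definition reject :: "'h::complex_inner \<Rightarrow> 'h \<Rightarrow> 'h" where
  "reject u v = v - scaleC (cinner v u) u"

lemma reject_linear:
  "reject u (v + w) = reject u v + reject u w"
  "reject u (scaleC c v) = scaleC c (reject u v)"
  by (simp_all add: reject_def cinner_add_left cinner_scaleC_left scaleC.scale_left_distrib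
      scaleC.scale_right_diff_distrib)

lemma norm_reject:
  assumes "norm u = 1"
  shows "(norm (reject u v))\<^sup>2 = (norm v)\<^sup>2 - (cmod (cinner v u))\<^sup>2"
proof -
  have uu: "cinner u u = 1" using assms by (simp add: cinner_self)
  have uv: "cinner u v = cnj (cinner v u)" by (rule cinner_commute)
  have "cinner (reject u v) (reject u v) = cinner v v - cinner v u * cnj (cinner v u)"
    by (simp add: reject_def cinner_diff_left cinner_diff_right cinner_scaleC_left cinner_scaleC_right uu uv)
  also have "\<dots> = of_real ((norm v)\<^sup>2 - (cmod (cinner v u))\<^sup>2)"
    by (simp add: cinner_self complex_norm_square[symmetric])
  finally show ?thesis by (simp add: norm_sq_eq_cinner)
qed

text \<open>
  The residual of the Kaczmarz iteration after \<open>n\<close> steps. Starting from \<open>v\<close> itself at \<open>n = 0\<close> makes the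
  index one larger than that of the iteration, and makes the shift \<open>rejects_Suc_shift\<close> hold without exceptions.
\<close>

primrec rejects :: "(nat \<Rightarrow> 'h::complex_inner) \<Rightarrow> nat \<Rightarrow> 'h \<Rightarrow> 'h" where
  "rejects e 0 v = v"
| "rejects e (Suc n) v = reject (e n) (rejects e n v)"

lemma rejects_Suc_shift: "rejects e (Suc n) v = rejects (\<lambda>k. e (Suc k)) n (reject (e 0) v)"
  by (induction n) simp_all

lemma rejects_linear:
  "rejects e n (v + w) = rejects e n v + rejects e n w"
  "rejects e n (scaleC c v) = scaleC c (rejects e n v)"
  by (induction n) (simp_all add: reject_linear)

lemma rejects_zero [simp]: "rejects e n 0 = 0"
  using rejects_linear(2)[of e n 0 0] by simp

lemma rejects_diff: "rejects e n (v - w) = rejects e n v - rejects e n w"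
  using rejects_linear(1)[of e n "v - w" w] by (simp add: algebra_simps)

text \<open>
  Pythagoras at each step; the residuals tend to \<open>0\<close> exactly when Parseval's identity holds for the
  coefficients subtracted on the way.
\<close>

lemma norm_rejects:
  assumes "\<And>n. norm (e n) = 1"
  shows "(norm (rejects e n v))\<^sup>2 = (norm v)\<^sup>2 - (\<Sum>i<n. (cmod (cinner (rejects e i v) (e i)))\<^sup>2)"
  by (induction n) (simp_all add: norm_reject assms)

lemma norm_rejects_le:
  assumes "\<And>n. norm (e n) = 1"
  shows "norm (rejects e n v) \<le> norm v"
proof -
  have "(norm (rejects e n v))\<^sup>2 \<le> (norm v)\<^sup>2"
    unfolding norm_rejects[OF assms] by (simp add: sum_nonneg)
  then show ?thesis by (rule power2_le_imp_le) simp
qed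

lemma rejects_eq_sum:
  "rejects e n v = v - (\<Sum>i<n. scaleC (cinner (rejects e i v) (e i)) (e i))"
  by (induction n) (simp_all add: reject_def)

text \<open>
  Polarization: norms determine the real part of the inner product, and rotating one argument by \<open>\<i>\<close>
  gives the imaginary part.
\<close>

lemma clinear_isometry_cinner:
  fixes T :: "'h::complex_inner \<Rightarrow> 'h"
  assumes T: "clinear_isometry T"
  shows "cinner (T x) (T y) = cinner x y"
proof -
  have Re: "Re (cinner (T x) (T y)) = Re (cinner x y)" for x y
  proof -
    have pol: "(norm (x + y))\<^sup>2 = (norm x)\<^sup>2 + (norm y)\<^sup>2 + 2 * Re (cinner x y)" for x y :: 'h
    proof -
      have "Re (cinner y x) = Re (cinner x y)" by (metis cinner_commute cnj.sel(1))
      then show ?thesis by (simp add: norm_sq_eq_cinner cinner_add_left cinner_add_right)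
    qed
    have "norm (T x + T y) = norm (x + y)" using T by (metis clinear_isometry_def)
    then show ?thesis using pol[of x y] pol[of "T x" "T y"] T by (simp add: clinear_isometry_def)
  qed
  have "Im (cinner u v) = - Re (cinner (scaleC \<i> u) v)" for u v :: 'h
    by (simp add: cinner_scaleC_left)
  then show ?thesis
    using Re[of x y] Re[of "scaleC \<i> x" y] T by (simp add: complex_eq_iff clinear_isometry_def)
qed

lemma reject_isometry:
  assumes "clinear_isometry T"
  shows "reject (T u) (T v) = T (reject u v)"
proof -
  have "T v = T (reject u v) + scaleC (cinner v u) (T u)"
    using assms by (metis clinear_isometry_def reject_def diff_add_cancel)
  then have "T (reject u v) = T v - scaleC (cinner v u) (T u)" by simp
  then show ?thesis by (simp add: reject_def clinear_isometry_cinner[OF assms])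
qed

text \<open>
  Rejection from \<open>T u\<close> after \<open>T\<close> is \<open>T\<close> after rejection from \<open>u\<close>. For a stationary sequence this relates
  the iterations that start at different indices.
\<close>

lemma rejects_isometry:
  assumes "clinear_isometry T"
  shows "rejects (\<lambda>k. T (e k)) n (T v) = T (rejects e n v)"
  by (induction n) (simp_all add: reject_isometry[OF assms])

lemma cinner_powers_isometry:
  assumes T: "clinear_isometry T" and e: "\<And>n. e n = (T ^^ n) (e 0)"
  shows "cinner (e i) (e (i + k)) = cinner (e 0) (e k)"
proof (induction i)
  case (Suc i)
  have "e (Suc n) = T (e n)" for n using e[of "Suc n"] e[of n] by simp
  then show ?case using Suc by (simp add: clinear_isometry_cinner[OF T])
qed simp

section \<open>Stationary sequences with singular spectral measure\<close>

text \<open>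
  Passes from a measure whose space is \<open>[0,1)\<close> to its image on the Borel sets of the line, where regularity
  and product measurability apply directly.
\<close>

lemma borel_extension_of_singular:
  assumes "borel_prob_unit_interval \<mu>" "lebesgue_singular \<mu>"
  obtains \<nu> N where "prob_space \<nu>" "sets \<nu> = sets borel"
    "N \<in> sets borel" "N \<subseteq> {0..<1}" "emeasure lborel N = 0" "emeasure \<nu> (UNIV - N) = 0"
    "\<And>n. fourier_coeff \<mu> n = (\<integral>y. cis (- 2 * pi * y) ^ n \<partial>\<nu>)"
proof -
  interpret prob_space \<mu> using assms(1) by (simp add: borel_prob_unit_interval_def)
  have sets: "sets \<mu> = sets (restrict_space borel {0..<1})"
    using assms(1) by (simp add: borel_prob_unit_interval_def)
  then have space: "space \<mu> = {0..<1}"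
    using sets_eq_imp_space_eq[OF sets] by (simp add: space_restrict_space)
  have id[measurable]: "(\<lambda>x. x) \<in> measurable \<mu> borel"
    by (subst measurable_cong_sets[OF sets refl]) (simp add: measurable_restrict_space1)
  define \<nu> where "\<nu> = distr \<mu> borel (\<lambda>x. x)"
  obtain N where N: "N \<in> sets \<mu>" "emeasure lborel N = 0" "emeasure \<mu> (space \<mu> - N) = 0"
    using assms(2) by (auto simp: lebesgue_singular_def)
  have Nb: "N \<in> sets borel" "N \<subseteq> {0..<1}"
    using N(1) sets.sets_into_space[OF N(1)] unfolding sets space
    by (auto simp: sets_restrict_space)
  show ?thesis
  proof (rule that)
    show "prob_space \<nu>" unfolding \<nu>_def by (rule prob_space_distr) simp
    show "emeasure \<nu> (UNIV - N) = 0"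
    proof -
      have "(UNIV - N) \<inter> space \<mu> = space \<mu> - N" by blast
      then show ?thesis unfolding \<nu>_def using Nb N(3) by (subst emeasure_distr) auto
    qed
    show "fourier_coeff \<mu> n = (\<integral>y. cis (- 2 * pi * y) ^ n \<partial>\<nu>)" for n
    proof -
      have "(\<lambda>y. cis (- 2 * pi * y) ^ n) \<in> borel_measurable borel"
        by (intro borel_measurable_continuous_onI continuous_intros)
      then have "(\<integral>y. cis (- 2 * pi * y) ^ n \<partial>\<nu>) = (\<integral>y. cis (- 2 * pi * y) ^ n \<partial>\<mu>)"
        unfolding \<nu>_def by (intro integral_distr) simp_all
      moreover have "(\<lambda>y. cis (- 2 * pi * y) ^ n) = (\<lambda>y. exp (- 2 * of_real pi * \<i> * of_nat n * of_real y))"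
        unfolding Complex.DeMoivre unfolding cis_conv_exp
        by (intro ext arg_cong[where f = exp]) (simp add: mult_ac)
      ultimately show ?thesis by (simp only: fourier_coeff_def)
    qed
  qed (use Nb N in \<open>auto simp: \<nu>_def\<close>)
qed

text \<open>
  The case of singular spectral measure of a theorem of Kwapien and Mycielski. The critical vector is the
  residual of \<open>e 0\<close> under rejection from \<open>e 1, e 2, \<dots>\<close>: stationarity makes its coefficients satisfy the
  convolution identity of \<open>inner_function_of_singular_measure\<close>, so that their squared moduli sum to
  \<open>1 = (norm (e 0))\<^sup>2\<close> and it tends to \<open>0\<close>.
  Induction on \<open>k\<close>, with one application of the isometry per step, yields the claim for all \<open>e k\<close>;
  rejections are linear contractions, so it extends to the closed span.
\<close>

theorem kwapien_mycielski_singular: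
  fixes e :: "nat \<Rightarrow> 'h::complex_inner"
  assumes "stationary e" and compl: "complete_seq e" and unit: "\<And>n. norm (e n) = 1"
    and \<mu>: "borel_prob_unit_interval \<mu>" "lebesgue_singular \<mu>"
    and coeff: "\<And>n. cinner (e 0) (e n) = fourier_coeff \<mu> n"
  shows "(\<lambda>n. rejects e n v) \<longlonglongrightarrow> 0"
proof -
  obtain T where T: "clinear_isometry T" and Te: "\<And>n. e n = (T ^^ n) (e 0)"
    using assms(1) by (metis stationary_def)
  have e_Suc: "e (Suc k) = T (e k)" for k using Te[of "Suc k"] Te[of k] by simp
  obtain \<nu> N where \<nu>: "prob_space \<nu>" "sets \<nu> = sets borel"
    and N: "N \<in> sets borel" "N \<subseteq> {0..<1}" "emeasure lborel N = 0" "emeasure \<nu> (UNIV - N) = 0"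
    and m: "\<And>n. fourier_coeff \<mu> n = (\<integral>y. cis (- 2 * pi * y) ^ n \<partial>\<nu>)"
    using borel_extension_of_singular[OF \<mu>] by metis
  define z where "z = (\<lambda>n. rejects (\<lambda>k. e (Suc k)) n (e 0))"
  \<comment> \<open>\<open>z n = e 0 - (\<Sum>i=1..n. a i e i)\<close>; there is no term with index \<open>0\<close>, so \<open>a 0 = 0\<close>.\<close>
  define a where "a = (\<lambda>n. case n of 0 \<Rightarrow> 0 | Suc k \<Rightarrow> cinner (z k) (e (Suc k)))"
  have a_simps [simp]: "a 0 = 0" "a (Suc k) = cinner (z k) (e (Suc k))" for k
    by (simp_all add: a_def)
  have norm_z: "(norm (z n))\<^sup>2 = 1 - (\<Sum>i<Suc n. (cmod (a i))\<^sup>2)" for n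
    unfolding sum.lessThan_Suc_shift z_def using norm_rejects[of "\<lambda>k. e (Suc k)" n "e 0"] unit
    by (simp add: z_def)
  have "(\<lambda>n. (cmod (a n))\<^sup>2) sums 1"
  proof (rule inner_function_of_singular_measure[OF \<nu> N])
    show "(\<Sum>i\<le>n. a i * (\<integral>y. cis (- 2 * pi * y) ^ (n - i) \<partial>\<nu>)) = (\<integral>y. cis (- 2 * pi * y) ^ n \<partial>\<nu>)"
      if "n > 0" for n
    proof -
      obtain k where n: "n = Suc k" using \<open>n > 0\<close> by (cases n) auto
      have ee: "cinner (e i) (e n) = fourier_coeff \<mu> (n - i)" if "i \<le> n" for i
        using cinner_powers_isometry[OF T Te, of i "n - i"] coeff that by simp
      \<comment> \<open>Expanding \<open>z k\<close> in \<open>a n = \<langle>z k, e n\<rangle>\<close> expresses \<open>a n\<close> through \<open>a i\<close> with \<open>i < n\<close> and Fourier coefficients.\<close>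
      have "z k = e 0 - (\<Sum>i<k. scaleC (a (Suc i)) (e (Suc i)))"
        unfolding z_def by (subst rejects_eq_sum) (simp add: z_def)
      then have "a n = cinner (e 0) (e n) - (\<Sum>i<k. a (Suc i) * cinner (e (Suc i)) (e n))"
        by (simp add: n cinner_diff_left cinner_sum_left cinner_scaleC_left)
      also have "(\<Sum>i<k. a (Suc i) * cinner (e (Suc i)) (e n)) = (\<Sum>i<k. a (Suc i) * fourier_coeff \<mu> (n - Suc i))"
        by (intro sum.cong refl) (subst ee, auto simp: n)
      also have "\<dots> = (\<Sum>i<n. a i * fourier_coeff \<mu> (n - i))"
        unfolding n sum.lessThan_Suc_shift by simp
      finally have "(\<Sum>i<n. a i * fourier_coeff \<mu> (n - i)) + a n = fourier_coeff \<mu> n"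
        by (simp add: coeff)
      moreover have "fourier_coeff \<mu> 0 = 1" using ee[of n] unit by (simp add: cinner_self)
      ultimately show ?thesis
        unfolding m[symmetric] lessThan_Suc_atMost[symmetric] by simp
    qed
    show "(\<Sum>i<n. (cmod (a i))\<^sup>2) \<le> 1" for n
    proof (cases n)
      case (Suc k)
      show ?thesis using norm_z[of k] zero_le_power2[of "norm (z k)"] unfolding Suc by linarith
    qed simp
  qed simp
  then have "(\<lambda>n. \<Sum>i<Suc n. (cmod (a i))\<^sup>2) \<longlonglongrightarrow> 1"
    unfolding sums_def by (rule LIMSEQ_Suc)
  then have "(\<lambda>n. sqrt (1 - (\<Sum>i<Suc n. (cmod (a i))\<^sup>2))) \<longlonglongrightarrow> sqrt (1 - 1)"
    by (intro tendsto_intros)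
  moreover have "sqrt (1 - (\<Sum>i<Suc n. (cmod (a i))\<^sup>2)) = norm (z n)" for n
    unfolding norm_z[symmetric] by simp
  ultimately have z: "z \<longlonglongrightarrow> 0" by (simp add: tendsto_norm_zero_iff)
  have ek: "(\<lambda>n. rejects e n (e k)) \<longlonglongrightarrow> 0" for k
  proof (induction k)
    case 0
    have "rejects e (Suc n) (e 0) = 0" for n
      unfolding rejects_Suc_shift using unit by (simp add: reject_def cinner_self)
    then have "(\<lambda>n. rejects e (Suc n) (e 0)) \<longlonglongrightarrow> 0" by simp
    then show ?case by (rule LIMSEQ_imp_Suc)
  next
    case (Suc k)
    \<comment> \<open>The first rejection, from \<open>e 0\<close>, splits \<open>e (k + 1)\<close> into itself and a multiple of \<open>e 0\<close>. The later ones
      act on \<open>e (k + 1) = T (e k)\<close> as the whole iteration acts on \<open>e k\<close>, and turn \<open>e 0\<close> into \<open>z n\<close>.\<close>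
    have "rejects e (Suc n) (e (Suc k)) = T (rejects e n (e k)) - scaleC (cinner (e (Suc k)) (e 0)) (z n)" for n
    proof -
      have "rejects (\<lambda>j. e (Suc j)) n (e (Suc k)) = T (rejects e n (e k))"
        unfolding e_Suc by (rule rejects_isometry[OF T])
      then show ?thesis
        unfolding rejects_Suc_shift by (simp add: reject_def rejects_diff rejects_linear z_def)
    qed
    note shift = this
    have "(\<lambda>n. T (rejects e n (e k))) \<longlonglongrightarrow> 0"
    proof (rule tendsto_norm_zero_cancel)
      have "norm (T x) = norm x" for x using T by (simp add: clinear_isometry_def)
      then show "(\<lambda>n. norm (T (rejects e n (e k)))) \<longlonglongrightarrow> 0" using tendsto_norm_zero[OF Suc] by simp
    qed
    from tendsto_diff[OF this tendsto_scaleC_zero[OF z, of "cinner (e (Suc k)) (e 0)"]]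
    have "(\<lambda>n. rejects e (Suc n) (e (Suc k))) \<longlonglongrightarrow> 0"
      unfolding shift diff_zero .
    then show ?case by (rule LIMSEQ_imp_Suc)
  qed
  have span: "(\<lambda>n. rejects e n x) \<longlonglongrightarrow> 0" if "x \<in> scaleC.span (range e)" for x
    using that
  proof (induction rule: scaleC.span_induct_alt)
    case base
    then show ?case by simp
  next
    case (step c x y)
    then have "(\<lambda>n. rejects e n x) \<longlonglongrightarrow> 0" using ek by auto
    from tendsto_add[OF tendsto_scaleC_zero[OF this] step(2)] show ?case by (simp add: rejects_linear)
  qed
  show ?thesis
  proof (rule LIMSEQ_I)
    fix \<epsilon> :: real assume \<epsilon>: "\<epsilon> > 0"
    have "v \<in> closure (scaleC.span (range e))" using compl by (simp add: complete_seq_def)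
    then obtain x where x: "x \<in> scaleC.span (range e)" "dist x v < \<epsilon> / 2"
      using \<epsilon> by (meson closure_approachable half_gt_zero)
    from LIMSEQ_D[OF span[OF x(1)] half_gt_zero[OF \<epsilon>]] obtain n0 where
      n0: "\<And>n. n \<ge> n0 \<Longrightarrow> norm (rejects e n x) < \<epsilon> / 2" by auto
    have "norm (rejects e n v - 0) < \<epsilon>" if "n \<ge> n0" for n
    proof -
      have "norm (rejects e n v) \<le> norm (rejects e n x) + norm (rejects e n (v - x))"
        unfolding rejects_diff by (rule norm_triangle_sub)
      also have "\<dots> < \<epsilon> / 2 + \<epsilon> / 2"
        using n0[OF that] x(2) norm_rejects_le[of e n "v - x", OF unit]
        by (simp add: dist_norm norm_minus_commute)
      finally show ?thesis by simp
    qed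
    then show "\<exists>n0. \<forall>n\<ge>n0. norm (rejects e n v - 0) < \<epsilon>" by blast
  qed
qed

section \<open>Continuous functions on a compact space\<close>

lemma cauchy_schwarz_cinner: "cmod (cinner x y) \<le> norm x * norm (y::'h::complex_inner)"
proof (cases "y = 0")
  case False
  define u where "u = scaleC (of_real (1 / norm y)) y"
  have u: "norm u = 1" using False by (simp add: u_def norm_scaleC norm_divide)
  have "(cmod (cinner x u))\<^sup>2 \<le> (norm x)\<^sup>2"
    using norm_reject[OF u, of x] zero_le_power2[of "norm (reject u x)"] by linarith
  then have "cmod (cinner x u) \<le> norm x" by (rule power2_le_imp_le) simp
  moreover have "cmod (cinner x u) = cmod (cinner x y) / norm y"
    by (simp add: u_def cinner_scaleC_right norm_mult norm_divide)
  ultimately show ?thesis using False by (simp add: divide_le_eq)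
qed simp

lemma bounded_bilinear_cinner: "bounded_bilinear (cinner :: 'h \<Rightarrow> 'h::complex_inner \<Rightarrow> complex)"
proof
  show "cinner (r *\<^sub>R x) y = r *\<^sub>R cinner x y" for r and x y :: 'h
    by (simp add: scaleR_scaleC cinner_scaleC_left scaleR_conv_of_real)
  show "cinner x (r *\<^sub>R y) = r *\<^sub>R cinner x y" for r and x y :: 'h
    by (simp add: scaleR_scaleC cinner_scaleC_right scaleR_conv_of_real)
  show "\<exists>K. \<forall>x y :: 'h. cmod (cinner x y) \<le> norm x * norm y * K"
    by (rule exI[of _ 1]) (simp add: cauchy_schwarz_cinner)
qed (simp_all add: cinner_add_left cinner_add_right)

lemma bounded_bilinear_scaleC: "bounded_bilinear (scaleC :: complex \<Rightarrow> 'h::complex_inner \<Rightarrow> 'h)"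
proof
  show "scaleC (r *\<^sub>R c) x = r *\<^sub>R scaleC c x" for r c and x :: 'h
    by (simp add: scaleR_scaleC scaleC_scaleC scaleR_conv_of_real)
  show "scaleC c (r *\<^sub>R x) = r *\<^sub>R scaleC c x" for r c and x :: 'h
    by (simp add: scaleR_scaleC scaleC_scaleC mult.commute)
  show "\<exists>K. \<forall>c (x::'h). norm (scaleC c x) \<le> norm c * norm x * K"
    by (rule exI[of _ 1]) (simp add: norm_scaleC)
qed (simp_all add: scaleC_add_left scaleC_add_right)

lemma continuous_map_cinner [continuous_intros]:
  "continuous_map X euclidean f \<Longrightarrow> continuous_map X euclidean g
    \<Longrightarrow> continuous_map X euclidean (\<lambda>x. cinner (f x) (g x :: 'h::complex_inner))"
  by (simp add: continuous_map_atin bounded_bilinear.tendsto[OF bounded_bilinear_cinner])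

lemma continuous_map_scaleC [continuous_intros]:
  "continuous_map X euclidean f \<Longrightarrow> continuous_map X euclidean g
    \<Longrightarrow> continuous_map X euclidean (\<lambda>x. scaleC (f x) (g x :: 'h::complex_inner))"
  by (simp add: continuous_map_atin bounded_bilinear.tendsto[OF bounded_bilinear_scaleC])

lemma continuous_map_complex_mult [continuous_intros]:
  fixes f g :: "'x \<Rightarrow> complex"
  shows "continuous_map X euclidean f \<Longrightarrow> continuous_map X euclidean g
    \<Longrightarrow> continuous_map X euclidean (\<lambda>x. f x * g x)"
  by (simp add: continuous_map_atin tendsto_mult)

lemma continuous_map_cnj [continuous_intros]:
  "continuous_map X euclidean f \<Longrightarrow> continuous_map X euclidean (\<lambda>x. cnj (f x))"
  by (simp add: continuous_map_atin tendsto_cnj)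

lemma continuous_map_of_real_norm [continuous_intros]:
  fixes f :: "'x \<Rightarrow> 'v::real_normed_vector"
  shows "continuous_map X euclidean f \<Longrightarrow> continuous_map X euclidean (\<lambda>x. complex_of_real (norm (f x)))"
  by (simp add: continuous_map_atin tendsto_of_real tendsto_norm)

definition cont_funs :: "'x topology \<Rightarrow> ('x \<Rightarrow> 'v::topological_space) set" where
  "cont_funs X = {f \<in> extensional (topspace X). continuous_map X euclidean f}"

definition sup_norm :: "'x topology \<Rightarrow> ('x \<Rightarrow> 'v::real_normed_vector) \<Rightarrow> real" where
  "sup_norm X f = Sup (insert 0 ((\<lambda>x. norm (f x)) ` topspace X))"

lemma cont_funs_eqI:
  assumes "f \<in> cont_funs X" "g \<in> cont_funs X" "\<And>x. x \<in> topspace X \<Longrightarrow> f x = g x"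
  shows "f = g"
  using assms by (auto simp: cont_funs_def intro: extensionalityI)

lemma restrict_in_cont_funs:
  "continuous_map X euclidean f \<Longrightarrow> (\<lambda>x\<in>topspace X. f x) \<in> cont_funs X"
  unfolding cont_funs_def by (auto intro: continuous_map_eq)

lemma cont_funsD: "f \<in> cont_funs X \<Longrightarrow> continuous_map X euclidean f"
  by (simp add: cont_funs_def)

lemma cont_funs_restrict_self: "f \<in> cont_funs X \<Longrightarrow> (\<lambda>x\<in>topspace X. f x) = f"
  by (auto simp: cont_funs_def extensional_restrict)

lemma restrict_eq_cont_fun:
  "f \<in> cont_funs X \<Longrightarrow> (\<And>x. x \<in> topspace X \<Longrightarrow> g x = f x) \<Longrightarrow> (\<lambda>x\<in>topspace X. g x) = f"
  using restrict_ext[of "topspace X" g f] by (simp add: cont_funs_restrict_self)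

lemma cont_funs_closed:
  shows "(\<lambda>x\<in>topspace X. c) \<in> cont_funs X"
    and "f \<in> cont_funs X \<Longrightarrow> g \<in> cont_funs X
      \<Longrightarrow> (\<lambda>x\<in>topspace X. f x + g x :: 'v::real_normed_vector) \<in> cont_funs X"
    and "f \<in> cont_funs X \<Longrightarrow> g \<in> cont_funs X
      \<Longrightarrow> (\<lambda>x\<in>topspace X. f x - g x :: 'v::real_normed_vector) \<in> cont_funs X"
    and "a \<in> cont_funs X \<Longrightarrow> b \<in> cont_funs X \<Longrightarrow> (\<lambda>x\<in>topspace X. a x * b x :: complex) \<in> cont_funs X"
    and "a \<in> cont_funs X \<Longrightarrow> (\<lambda>x\<in>topspace X. z * a x) \<in> cont_funs X"
    and "a \<in> cont_funs X \<Longrightarrow> (\<lambda>x\<in>topspace X. cnj (a x)) \<in> cont_funs X"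
  by (intro restrict_in_cont_funs continuous_intros; (simp add: cont_funsD)?)+

lemma cont_funs_closed_hilbert:
  fixes u v :: "'x \<Rightarrow> 'h::complex_inner"
  assumes "u \<in> cont_funs X"
  shows "a \<in> cont_funs X \<Longrightarrow> (\<lambda>x\<in>topspace X. scaleC (a x) (u x)) \<in> cont_funs X"
    and "(\<lambda>x\<in>topspace X. scaleC z (u x)) \<in> cont_funs X"
    and "v \<in> cont_funs X \<Longrightarrow> (\<lambda>x\<in>topspace X. cinner (u x) (v x)) \<in> cont_funs X"
    and "(\<lambda>x\<in>topspace X. complex_of_real (norm (u x))) \<in> cont_funs X"
  using assms by (intro restrict_in_cont_funs continuous_intros; (simp add: cont_funsD)?)+

lemma sup_norm_upper:
  assumes "compact_space X" "f \<in> cont_funs X" "x \<in> topspace X"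
  shows "norm (f x) \<le> sup_norm X f"
proof -
  have "compact ((\<lambda>x. norm (f x)) ` topspace X)"
    using image_compactin[OF _ continuous_map_norm[OF cont_funsD[OF assms(2)]]] assms(1)
    by (simp add: compact_space_def)
  then have "bdd_above (insert 0 ((\<lambda>x. norm (f x)) ` topspace X))"
    by (simp add: compact_imp_bounded bounded_imp_bdd_above)
  then show ?thesis unfolding sup_norm_def using assms(3) by (intro cSup_upper) auto
qed

lemma sup_norm_least:
  "(\<And>x. x \<in> topspace X \<Longrightarrow> norm (f x) \<le> B) \<Longrightarrow> 0 \<le> B \<Longrightarrow> sup_norm X f \<le> B"
  unfolding sup_norm_def by (intro cSup_least) auto

lemma sup_norm_nonneg:
  assumes "compact_space X" "f \<in> cont_funs X"
  shows "0 \<le> sup_norm X f"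
proof (cases "topspace X = {}")
  case False
  then obtain x where x: "x \<in> topspace X" by blast
  show ?thesis using order_trans[OF norm_ge_zero sup_norm_upper[OF assms x]] .
qed (simp add: sup_norm_def)

lemma sup_norm_eq_zero_iff:
  assumes "compact_space X" "f \<in> cont_funs X"
  shows "sup_norm X f = 0 \<longleftrightarrow> f = (\<lambda>x\<in>topspace X. 0)"
proof
  assume 0: "sup_norm X f = 0"
  show "f = (\<lambda>x\<in>topspace X. 0)"
    by (rule cont_funs_eqI[OF assms(2) restrict_in_cont_funs])
       (use sup_norm_upper[OF assms] 0 in auto)
next
  assume "f = (\<lambda>x\<in>topspace X. 0)"
  then have "sup_norm X f \<le> 0" by (intro sup_norm_least) auto
  with sup_norm_nonneg[OF assms] show "sup_norm X f = 0" by simp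
qed

lemma sup_norm_scale_le:
  assumes "compact_space X" "f \<in> cont_funs X" and c: "0 \<le> c"
    and "\<And>x. x \<in> topspace X \<Longrightarrow> norm (g x) \<le> c * norm (f x)"
  shows "sup_norm X g \<le> c * sup_norm X f"
proof (rule sup_norm_least)
  show "norm (g x) \<le> c * sup_norm X f" if "x \<in> topspace X" for x
    using assms(4)[OF that] mult_left_mono[OF sup_norm_upper[OF assms(1,2) that] c] by linarith
qed (use sup_norm_nonneg[OF assms(1,2)] c in simp)

text \<open>
  Used twice: for the C*-identity of \<open>C(X)\<close>, and to see that the norm of the module \<open>C(X,H')\<close> is the supremum norm.
\<close>

lemma sup_norm_power2:
  assumes X: "compact_space X" and f: "f \<in> cont_funs X" and g: "g \<in> cont_funs X"
    and eq: "\<And>x. x \<in> topspace X \<Longrightarrow> norm (g x) = (norm (f x))\<^sup>2"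
  shows "sup_norm X g = (sup_norm X f)\<^sup>2"
proof (rule antisym)
  show "sup_norm X g \<le> (sup_norm X f)\<^sup>2"
    by (rule sup_norm_least) (auto simp: eq intro!: power_mono sup_norm_upper X f)
  have "sup_norm X f \<le> sqrt (sup_norm X g)"
    by (rule sup_norm_least)
       (auto intro!: real_le_rsqrt sup_norm_nonneg X g simp: eq[symmetric] sup_norm_upper[OF X g])
  then have "(sup_norm X f)\<^sup>2 \<le> (sqrt (sup_norm X g))\<^sup>2"
    using sup_norm_nonneg[OF X f] by (intro power_mono)
  then show "(sup_norm X f)\<^sup>2 \<le> sup_norm X g" using sup_norm_nonneg[OF X g] by simp
qed

text \<open>
  A uniformly Cauchy sequence has a pointwise limit, the convergence is uniform, and a uniform limit
  of continuous functions is continuous. Needed for scalar values and for values in \<open>H'\<close>.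
\<close>

lemma cont_funs_complete:
  fixes s :: "nat \<Rightarrow> 'x \<Rightarrow> 'v::{real_normed_vector, complete_space}"
  assumes X: "compact_space X" and s: "\<And>n. s n \<in> cont_funs X"
    and cauchy: "\<And>\<epsilon>. \<epsilon> > 0 \<Longrightarrow> \<exists>K. \<forall>m\<ge>K. \<forall>n\<ge>K. sup_norm X (\<lambda>x\<in>topspace X. s m x - s n x) < \<epsilon>"
  shows "\<exists>l\<in>cont_funs X. (\<lambda>n. sup_norm X (\<lambda>x\<in>topspace X. s n x - l x)) \<longlonglongrightarrow> 0"
proof -
  have diff: "(\<lambda>x\<in>topspace X. f x - g x) \<in> cont_funs X" if "f \<in> cont_funs X" "g \<in> cont_funs X"
    for f g :: "'x \<Rightarrow> 'v"
    using that by (intro restrict_in_cont_funs continuous_intros cont_funsD)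
  have pt: "\<exists>K. \<forall>m\<ge>K. \<forall>n\<ge>K. \<forall>x\<in>topspace X. norm (s m x - s n x) < \<epsilon>" if \<epsilon>: "\<epsilon> > 0" for \<epsilon>
  proof -
    obtain K where K: "\<And>m n. m \<ge> K \<Longrightarrow> n \<ge> K \<Longrightarrow> sup_norm X (\<lambda>x\<in>topspace X. s m x - s n x) < \<epsilon>"
      using cauchy[OF \<epsilon>] by blast
    have "norm (s m x - s n x) < \<epsilon>" if "m \<ge> K" "n \<ge> K" "x \<in> topspace X" for m n x
      using sup_norm_upper[OF X diff[OF s s] that(3), of m n] K[OF that(1,2)] that(3) by simp
    then show ?thesis by blast
  qed
  define l where "l = (\<lambda>x\<in>topspace X. lim (\<lambda>n. s n x))"
  have l: "(\<lambda>n. s n x) \<longlonglongrightarrow> l x" if x: "x \<in> topspace X" for x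
  proof -
    have "Cauchy (\<lambda>n. s n x)"
      unfolding Cauchy_iff using pt x by meson
    then show ?thesis using x by (simp add: l_def Cauchy_convergent convergent_LIMSEQ_iff[symmetric])
  qed
  have unif: "\<exists>K. \<forall>n\<ge>K. \<forall>x\<in>topspace X. norm (s n x - l x) \<le> \<epsilon>" if \<epsilon>: "\<epsilon> > 0" for \<epsilon>
  proof -
    obtain K where K: "\<forall>m\<ge>K. \<forall>n\<ge>K. \<forall>x\<in>topspace X. norm (s m x - s n x) < \<epsilon>" using pt[OF \<epsilon>] by blast
    have "norm (s n x - l x) \<le> \<epsilon>" if "n \<ge> K" "x \<in> topspace X" for n x
    proof (rule LIMSEQ_le_const2)
      show "(\<lambda>m. norm (s n x - s m x)) \<longlonglongrightarrow> norm (s n x - l x)"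
        by (intro tendsto_intros l that)
      show "\<exists>N. \<forall>m\<ge>N. norm (s n x - s m x) \<le> \<epsilon>" using K that by (meson less_imp_le)
    qed
    then show ?thesis by blast
  qed
  have "continuous_map X euclidean l"
    unfolding continuous_map_atin limitin_canonical_iff
  proof (intro ballI tendstoI)
    fix x and \<epsilon> :: real assume x: "x \<in> topspace X" and "\<epsilon> > 0"
    then obtain K where K: "\<forall>y\<in>topspace X. norm (s K y - l y) \<le> \<epsilon> / 4"
      using unif[of "\<epsilon> / 4"] by auto
    have "(s K \<longlongrightarrow> s K x) (atin X x)"
      using cont_funsD[OF s, of K] x by (simp add: continuous_map_atin)
    then have "\<forall>\<^sub>F y in atin X x. dist (s K y) (s K x) < \<epsilon> / 4"
      using \<open>\<epsilon> > 0\<close> by (intro tendstoD) auto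
    moreover have "\<forall>\<^sub>F y in atin X x. y \<in> topspace X"
      using x by (auto simp: eventually_atin)
    ultimately show "\<forall>\<^sub>F y in atin X x. dist (l y) (l x) < \<epsilon>"
    proof eventually_elim
      case (elim y)
      have "dist (l y) (l x) \<le> dist (s K y) (l y) + dist (s K y) (s K x) + dist (s K x) (l x)"
        using dist_triangle[of "l y" "l x" "s K y"] dist_triangle[of "s K y" "l x" "s K x"]
        by (simp add: dist_commute)
      also have "\<dots> < \<epsilon>"
        using elim(1) bspec[OF K elim(2)] bspec[OF K x] \<open>\<epsilon> > 0\<close> by (simp add: dist_norm)
      finally show ?case .
    qed
  qed
  then have lC: "l \<in> cont_funs X" by (simp add: cont_funs_def l_def)
  have "(\<lambda>n. sup_norm X (\<lambda>x\<in>topspace X. s n x - l x)) \<longlonglongrightarrow> 0"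
  proof (rule LIMSEQ_I)
    fix \<epsilon> :: real assume "\<epsilon> > 0"
    then obtain K where K: "\<And>n x. n \<ge> K \<Longrightarrow> x \<in> topspace X \<Longrightarrow> norm (s n x - l x) \<le> \<epsilon> / 2"
      using unif[of "\<epsilon> / 2"] by auto
    have "norm (sup_norm X (\<lambda>x\<in>topspace X. s n x - l x) - 0) < \<epsilon>" if "n \<ge> K" for n
      using sup_norm_nonneg[OF X diff[OF s lC], of n]
        sup_norm_least[of X "\<lambda>x\<in>topspace X. s n x - l x" "\<epsilon> / 2"] K[OF that] \<open>\<epsilon> > 0\<close> by fastforce
    then show "\<exists>K. \<forall>n\<ge>K. norm (sup_norm X (\<lambda>x\<in>topspace X. s n x - l x) - 0) < \<epsilon>" by blast
  qed
  with lC show ?thesis by blast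
qed

text \<open>
  Subtraction in a ring record is defined through an inverse of the additive group, so it has to be
  computed; this serves both \<open>C_alg\<close> and \<open>C_mod\<close>.
\<close>

lemma cont_funs_abelian_group:
  fixes G :: "('x \<Rightarrow> 'v::real_normed_vector, 'm) ring_scheme"
  assumes "carrier G = cont_funs X" "add G = (\<lambda>f g. \<lambda>x\<in>topspace X. f x + g x)"
    "\<zero>\<^bsub>G\<^esub> = (\<lambda>x\<in>topspace X. 0)"
  shows "abelian_group G"
    and "f \<in> cont_funs X \<Longrightarrow> g \<in> cont_funs X \<Longrightarrow> f \<ominus>\<^bsub>G\<^esub> g = (\<lambda>x\<in>topspace X. f x - g x)"
proof -
  have neg: "(\<lambda>x\<in>topspace X. - f x) \<in> cont_funs X" if "f \<in> cont_funs X" for f :: "'x \<Rightarrow> 'v"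
    using cont_funsD[OF that] by (intro restrict_in_cont_funs) simp
  have "\<exists>g\<in>cont_funs X. (\<lambda>x\<in>topspace X. g x + f x) = (\<lambda>x\<in>topspace X. 0)"
    if "f \<in> cont_funs X" for f :: "'x \<Rightarrow> 'v"
    using neg[OF that] by (intro bexI[of _ "\<lambda>x\<in>topspace X. - f x"]) auto
  note inverse = this
  show G: "abelian_group G"
  proof (rule abelian_groupI, unfold assms)
    fix f g h :: "'x \<Rightarrow> 'v"
    assume f: "f \<in> cont_funs X" and g: "g \<in> cont_funs X"
    show "(\<lambda>x\<in>topspace X. f x + g x) \<in> cont_funs X"
      by (intro restrict_in_cont_funs continuous_map_add cont_funsD f g)
    show "(\<lambda>x\<in>topspace X. (\<lambda>x\<in>topspace X. f x + g x) x + h x)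
        = (\<lambda>x\<in>topspace X. f x + (\<lambda>x\<in>topspace X. g x + h x) x)"
      by (intro restrict_ext) (simp add: add.assoc)
    show "(\<lambda>x\<in>topspace X. f x + g x) = (\<lambda>x\<in>topspace X. g x + f x)"
      by (intro restrict_ext) (rule add.commute)
  next
    show "(\<lambda>x\<in>topspace X. 0 :: 'v) \<in> cont_funs X"
      by (intro restrict_in_cont_funs) simp
    fix f :: "'x \<Rightarrow> 'v" assume f: "f \<in> cont_funs X"
    show "(\<lambda>x\<in>topspace X. (\<lambda>x\<in>topspace X. 0) x + f x) = f"
      using restrict_ext[of "topspace X" "\<lambda>x. (\<lambda>x\<in>topspace X. 0) x + f x" f]
      by (simp add: cont_funs_restrict_self[OF f])
  qed (rule inverse)
  interpret abelian_group G by fact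
  assume fg: "f \<in> cont_funs X" "g \<in> cont_funs X"
  have "\<ominus>\<^bsub>G\<^esub> g = (\<lambda>x\<in>topspace X. - g x)"
    by (rule minus_equality) (use fg neg assms in auto)
  then show "f \<ominus>\<^bsub>G\<^esub> g = (\<lambda>x\<in>topspace X. f x - g x)"
    by (auto simp: a_minus_def assms)
qed

section \<open>The Hilbert module of continuous functions\<close>

lemma C_alg_simps [simp]:
  "carrier (C_alg X) = cont_funs X"
  "f \<otimes>\<^bsub>C_alg X\<^esub> g = (\<lambda>x\<in>topspace X. f x * g x)"
  "\<one>\<^bsub>C_alg X\<^esub> = (\<lambda>x\<in>topspace X. 1)"
  "\<zero>\<^bsub>C_alg X\<^esub> = (\<lambda>x\<in>topspace X. 0)"
  "f \<oplus>\<^bsub>C_alg X\<^esub> g = (\<lambda>x\<in>topspace X. f x + g x)"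
  "c \<odot>\<^bsub>C_alg X\<^esub> f = (\<lambda>x\<in>topspace X. c * f x)"
  "adj (C_alg X) f = (\<lambda>x\<in>topspace X. cnj (f x))"
  "cnorm (C_alg X) f = sup_norm X f"
  by (simp_all add: C_alg_def cont_funs_def sup_norm_def)

lemma C_mod_simps [simp]:
  "carrier (C_mod X) = cont_funs X"
  "\<zero>\<^bsub>C_mod X\<^esub> = (\<lambda>x\<in>topspace X. 0)"
  "f \<oplus>\<^bsub>C_mod X\<^esub> g = (\<lambda>x\<in>topspace X. f x + g x)"
  "c \<odot>\<^bsub>C_mod X\<^esub> f = (\<lambda>x\<in>topspace X. scaleC c (f x))"
  "act (C_mod X) a f = (\<lambda>x\<in>topspace X. scaleC (a x) (f x))"
  "ip (C_mod X) f g = (\<lambda>x\<in>topspace X. cinner (f x) (g x))"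
  by (simp_all add: C_mod_def cont_funs_def)

lemma C_alg_group: "abelian_group (C_alg X)"
  and C_alg_minus: "f \<in> cont_funs X \<Longrightarrow> g \<in> cont_funs X \<Longrightarrow> f \<ominus>\<^bsub>C_alg X\<^esub> g = (\<lambda>x\<in>topspace X. f x - g x)"
  by (rule cont_funs_abelian_group; simp add: C_alg_def cont_funs_def; fail)+

lemma C_mod_group: "abelian_group (C_mod X)"
  and C_mod_minus: "f \<in> cont_funs X \<Longrightarrow> g \<in> cont_funs X \<Longrightarrow> f \<ominus>\<^bsub>C_mod X\<^esub> g = (\<lambda>x\<in>topspace X. f x - g x)"
  by (rule cont_funs_abelian_group; simp add: C_mod_def cont_funs_def; fail)+

lemma complex_ring_simps [simp]:
  "carrier complex_ring = UNIV" "a \<otimes>\<^bsub>complex_ring\<^esub> b = a * b" "\<one>\<^bsub>complex_ring\<^esub> = 1"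
  "\<zero>\<^bsub>complex_ring\<^esub> = 0" "a \<oplus>\<^bsub>complex_ring\<^esub> b = a + b"
  by (simp_all add: complex_ring_def)

lemma cring_complex_ring: "cring complex_ring"
  by (intro cringI abelian_groupI comm_monoidI)
     (auto simp: algebra_simps intro: exI[of _ "- _"] add.left_inverse)

lemma unital_cstar_algebra_C_alg:
  assumes X: "compact_space X"
  shows "unital_cstar_algebra (C_alg X)"
proof -
  show ?thesis
  proof (rule unital_cstar_algebra.intro)
    show "Ring.ring (C_alg X)"
    proof (rule ringI[OF C_alg_group])
      show "monoid (C_alg X)"
        by (rule monoidI)
           (auto intro!: cont_funs_closed restrict_ext simp: mult.assoc intro: restrict_eq_cont_fun)
    qed (auto simp: algebra_simps intro!: restrict_ext)
    show "module complex_ring (C_alg X)"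
      by (rule moduleI[OF cring_complex_ring C_alg_group])
         (auto intro!: cont_funs_closed restrict_ext intro: restrict_eq_cont_fun simp: algebra_simps)
    show "cnorm (C_alg X) (c \<odot>\<^bsub>C_alg X\<^esub> a) = cmod c * cnorm (C_alg X) a"
      if "a \<in> carrier (C_alg X)" for a c
    proof (rule antisym)
      have a: "a \<in> cont_funs X" using that by simp
      have ca: "(\<lambda>x\<in>topspace X. c * a x) \<in> cont_funs X" using a by (intro cont_funs_closed)
      show "cnorm (C_alg X) (c \<odot>\<^bsub>C_alg X\<^esub> a) \<le> cmod c * cnorm (C_alg X) a"
        unfolding C_alg_simps by (rule sup_norm_scale_le[OF X a]) (simp_all add: norm_mult)
      show "cmod c * cnorm (C_alg X) a \<le> cnorm (C_alg X) (c \<odot>\<^bsub>C_alg X\<^esub> a)"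
      proof (cases "c = 0")
        case False
        then have "sup_norm X a \<le> (1 / cmod c) * sup_norm X (\<lambda>x\<in>topspace X. c * a x)"
          by (intro sup_norm_scale_le[OF X ca]) (auto simp: norm_mult)
        then show ?thesis using False by (simp add: field_simps)
      qed (use sup_norm_nonneg[OF X ca] in simp)
    qed
    show "cnorm (C_alg X) (adj (C_alg X) a \<otimes>\<^bsub>C_alg X\<^esub> a) = (cnorm (C_alg X) a)\<^sup>2"
      if "a \<in> carrier (C_alg X)" for a
    proof -
      have a: "a \<in> cont_funs X" using that by simp
      have "(\<lambda>x\<in>topspace X. (\<lambda>x\<in>topspace X. cnj (a x)) x * a x) \<in> cont_funs X"
        by (intro cont_funs_closed a)
      from sup_norm_power2[OF X a this] show ?thesis
        by (simp add: norm_mult power2_eq_square)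
    qed
    show "cnorm (C_alg X) (a \<oplus>\<^bsub>C_alg X\<^esub> b) \<le> cnorm (C_alg X) a + cnorm (C_alg X) b"
      if "a \<in> carrier (C_alg X)" "b \<in> carrier (C_alg X)" for a b
      using that X unfolding C_alg_simps
      by (intro sup_norm_least)
         (auto intro!: norm_triangle_mono sup_norm_upper add_nonneg_nonneg sup_norm_nonneg)
    show "cnorm (C_alg X) (a \<otimes>\<^bsub>C_alg X\<^esub> b) \<le> cnorm (C_alg X) a * cnorm (C_alg X) b"
      if "a \<in> carrier (C_alg X)" "b \<in> carrier (C_alg X)" for a b
      using that X unfolding C_alg_simps
      by (intro sup_norm_least)
         (auto simp: norm_mult intro!: mult_mono sup_norm_upper mult_nonneg_nonneg sup_norm_nonneg)
    show "complete_wrt (C_alg X) (cnorm (C_alg X))"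
      unfolding complete_wrt_def
    proof (intro allI impI, elim conjE)
      fix s :: "nat \<Rightarrow> 'a \<Rightarrow> complex"
      assume "\<forall>n. s n \<in> carrier (C_alg X)"
        and "\<forall>\<epsilon>>0. \<exists>K. \<forall>m\<ge>K. \<forall>n\<ge>K. cnorm (C_alg X) (s m \<ominus>\<^bsub>C_alg X\<^esub> s n) < \<epsilon>"
      then show "\<exists>l\<in>carrier (C_alg X). (\<lambda>n. cnorm (C_alg X) (s n \<ominus>\<^bsub>C_alg X\<^esub> l)) \<longlonglongrightarrow> 0"
        using cont_funs_complete[OF X, of s] by (simp add: C_alg_minus cong: bex_cong)
    qed
  qed (use X in \<open>auto intro!: cont_funs_closed restrict_ext intro: restrict_eq_cont_fun simp: algebra_simps
        sup_norm_nonneg sup_norm_eq_zero_iff\<close>)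
qed

lemma hnorm_C_mod:
  assumes "compact_space X" "f \<in> cont_funs X"
  shows "hnorm (C_alg X) (C_mod X) f = sup_norm X f"
proof -
  have "sup_norm X (\<lambda>x\<in>topspace X. cinner (f x) (f x)) = (sup_norm X f)\<^sup>2"
  proof (rule sup_norm_power2[OF assms])
    show "(\<lambda>x\<in>topspace X. cinner (f x) (f x)) \<in> cont_funs X"
      by (intro restrict_in_cont_funs continuous_intros cont_funsD assms)
  qed (simp add: cinner_self norm_power)
  then show ?thesis using sup_norm_nonneg[OF assms] by (simp add: hnorm_def)
qed

lemma hilbert_module_C_mod:
  assumes X: "compact_space X"
  shows "hilbert_module (C_alg X) (C_mod X :: ('x \<Rightarrow> complex, 'x \<Rightarrow> 'h::chilbert_space) hilbert_mod)"
proof -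
  let ?H = "C_mod X :: ('x \<Rightarrow> complex, 'x \<Rightarrow> 'h::chilbert_space) hilbert_mod"
  show ?thesis
  proof (rule hilbert_module.intro)
    show "unital_cstar_algebra (C_alg X)" by (rule unital_cstar_algebra_C_alg[OF X])
    show "module complex_ring ?H"
      by (rule moduleI[OF cring_complex_ring C_mod_group])
         (auto intro!: cont_funs_closed cont_funs_closed_hilbert restrict_ext intro: restrict_eq_cont_fun
           simp: scaleC_add_left scaleC_add_right scaleC_scaleC)
    show "cstar_positive (C_alg X) (ip ?H f f)" if "f \<in> carrier ?H" for f
      unfolding cstar_positive_def
    proof (rule bexI)
      \<comment> \<open>The pointwise norm is a continuous square root of \<open>\<langle>f, f\<rangle>\<close>.\<close>
      show "(\<lambda>x\<in>topspace X. complex_of_real (norm (f x))) \<in> carrier (C_alg X)"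
        using that by (auto intro!: cont_funs_closed cont_funs_closed_hilbert)
      show "ip ?H f f = adj (C_alg X) (\<lambda>x\<in>topspace X. complex_of_real (norm (f x))) \<otimes>\<^bsub>C_alg X\<^esub>
          (\<lambda>x\<in>topspace X. complex_of_real (norm (f x)))"
        by (auto simp: cinner_self power2_eq_square)
    qed
    show "ip ?H f f = \<zero>\<^bsub>C_alg X\<^esub> \<longleftrightarrow> f = \<zero>\<^bsub>?H\<^esub>" if "f \<in> carrier ?H" for f
    proof
      assume 0: "ip ?H f f = \<zero>\<^bsub>C_alg X\<^esub>"
      have "cinner (f x) (f x) = 0" if "x \<in> topspace X" for x
        using fun_cong[OF 0, of x] that by simp
      then show "f = \<zero>\<^bsub>?H\<^esub>"
        using that by (auto intro!: cont_funs_eqI cont_funs_closed cont_funs_closed_hilbert simp: cinner_eq_zero_iff)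
    qed auto
    show "ip ?H f g = adj (C_alg X) (ip ?H g f)" for f g
      using cinner_commute by (auto intro!: restrict_ext)
    show "complete_wrt ?H (hnorm (C_alg X) ?H)"
      unfolding complete_wrt_def
    proof (intro allI impI, elim conjE)
      fix s :: "nat \<Rightarrow> 'x \<Rightarrow> 'h"
      assume s: "\<forall>n. s n \<in> carrier ?H"
        and c: "\<forall>\<epsilon>>0. \<exists>K. \<forall>m\<ge>K. \<forall>n\<ge>K. hnorm (C_alg X) ?H (s m \<ominus>\<^bsub>?H\<^esub> s n) < \<epsilon>"
      have norm: "hnorm (C_alg X) ?H (f \<ominus>\<^bsub>?H\<^esub> g) = sup_norm X (\<lambda>x\<in>topspace X. f x - g x)"
        if "f \<in> cont_funs X" "g \<in> cont_funs X" for f g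
        unfolding C_mod_minus[OF that]
        by (rule hnorm_C_mod[OF X]) (use that in \<open>intro cont_funs_closed cont_funs_closed_hilbert\<close>)
      show "\<exists>l\<in>carrier ?H. (\<lambda>n. hnorm (C_alg X) ?H (s n \<ominus>\<^bsub>?H\<^esub> l)) \<longlonglongrightarrow> 0"
        using cont_funs_complete[OF X, of s] s c by (simp add: norm cong: bex_cong)
    qed
  qed (auto intro!: cont_funs_closed cont_funs_closed_hilbert restrict_ext intro: restrict_eq_cont_fun simp: scaleC_add_left scaleC_add_right
        scaleC_scaleC cinner_add_left cinner_scaleC_left mult.commute)
qed

section \<open>Effectiveness\<close>

lemma continuous_map_rejects [continuous_intros]:
  assumes "continuous_map X euclidean f"
  shows "continuous_map X euclidean (\<lambda>x. rejects e n (f x))"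
  by (induction n) (auto simp: reject_def intro!: continuous_intros assms)

lemma kaczmarz_C_mod:
  assumes f: "f \<in> cont_funs X"
  shows "kaczmarz (C_mod X) (const_seq X e) f n = (\<lambda>x\<in>topspace X. f x - rejects e (Suc n) (f x))"
proof (induction n)
  case 0
  show ?case by (auto simp: const_seq_def reject_def)
next
  case (Suc n)
  have "(\<lambda>x\<in>topspace X. f x - rejects e (Suc n) (f x)) \<in> cont_funs X"
    by (intro restrict_in_cont_funs continuous_intros cont_funsD f)
  then show ?case
    unfolding kaczmarz.simps Suc by (auto simp: C_mod_minus f const_seq_def reject_def)
qed

text \<open>
  Rejections are contractions, so pointwise convergence on a finite \<open>\<epsilon>/2\<close>-net of \<open>S\<close> is enough.
\<close>

lemma rejects_uniform_on_compact:
  fixes S :: "'h::complex_inner set"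
  assumes S: "compact S" and unit: "\<And>n. norm (e n) = 1"
    and lim: "\<And>v. v \<in> S \<Longrightarrow> (\<lambda>n. rejects e n v) \<longlonglongrightarrow> 0" and \<epsilon>: "\<epsilon> > 0"
  shows "\<forall>\<^sub>F n in sequentially. \<forall>v\<in>S. norm (rejects e n v) < \<epsilon>"
proof -
  obtain F where F: "finite F" "F \<subseteq> S" "S \<subseteq> (\<Union>w\<in>F. ball w (\<epsilon> / 2))"
    using seq_compact_imp_totally_bounded[OF compact_imp_seq_compact[OF S]] \<epsilon> by (meson half_gt_zero)
  have "\<forall>\<^sub>F n in sequentially. \<forall>w\<in>F. norm (rejects e n w) < \<epsilon> / 2"
  proof (intro eventually_ball_finite F(1) ballI)
    fix w assume "w \<in> F"
    then have "(\<lambda>n. rejects e n w) \<longlonglongrightarrow> 0" using F(2) by (intro lim) blast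
    from tendstoD[OF this half_gt_zero[OF \<epsilon>]]
    show "\<forall>\<^sub>F n in sequentially. norm (rejects e n w) < \<epsilon> / 2" by simp
  qed
  then show ?thesis
  proof eventually_elim
    case (elim n)
    show ?case
    proof
      fix v assume "v \<in> S"
      then obtain w where w: "w \<in> F" "dist w v < \<epsilon> / 2" using F(3) by auto
      have "norm (rejects e n v) \<le> norm (rejects e n w) + norm (rejects e n (v - w))"
        unfolding rejects_diff by (rule norm_triangle_sub)
      also have "\<dots> < \<epsilon> / 2 + \<epsilon> / 2"
        using elim w norm_rejects_le[of e n "v - w", OF unit]
        by (fastforce simp: dist_norm norm_minus_commute)
      finally show "norm (rejects e n v) < \<epsilon>" by simp
    qed
  qed
qed

text \<open>
  The iteration in \<open>C(X,H')\<close> is the iteration in \<open>H'\<close> at every point, so the error at stage \<open>n\<close> is the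
  supremum of the norm of the residual over the compact set \<open>f ` X\<close>.
\<close>

lemma effective_const_seq:
  fixes e :: "nat \<Rightarrow> 'h::complex_inner"
  assumes X: "compact_space X" and unit: "\<And>n. norm (e n) = 1"
    and lim: "\<And>v. (\<lambda>n. rejects e n v) \<longlonglongrightarrow> 0"
  shows "effective (C_alg X) (C_mod X) (const_seq X e)"
  unfolding effective_def
proof (intro conjI allI ballI)
  show "const_seq X e n \<in> carrier (C_mod X)" for n
    unfolding const_seq_def by (auto intro!: restrict_in_cont_funs)
  show "ip (C_mod X) (const_seq X e n) (const_seq X e n) = \<one>\<^bsub>C_alg X\<^esub>" for n
    using unit by (auto simp: const_seq_def cinner_self)
  fix f :: "'a \<Rightarrow> 'h" assume "f \<in> carrier (C_mod X)"
  then have f: "f \<in> cont_funs X" by simp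
  have err: "hnorm (C_alg X) (C_mod X) (kaczmarz (C_mod X) (const_seq X e) f n \<ominus>\<^bsub>C_mod X\<^esub> f)
      = sup_norm X (\<lambda>x\<in>topspace X. - rejects e (Suc n) (f x))" for n
  proof -
    have "(\<lambda>x\<in>topspace X. f x - rejects e (Suc n) (f x)) \<in> cont_funs X"
      by (intro restrict_in_cont_funs continuous_intros cont_funsD f)
    then have "kaczmarz (C_mod X) (const_seq X e) f n \<ominus>\<^bsub>C_mod X\<^esub> f
        = (\<lambda>x\<in>topspace X. - rejects e (Suc n) (f x))"
      unfolding kaczmarz_C_mod[OF f] by (subst C_mod_minus[OF _ f]) auto
    moreover have "(\<lambda>x\<in>topspace X. - rejects e (Suc n) (f x)) \<in> cont_funs X"
      by (intro restrict_in_cont_funs continuous_map_minus continuous_intros cont_funsD f)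
    ultimately show ?thesis by (simp only: hnorm_C_mod[OF X])
  qed
  have "compact (f ` topspace X)"
    using image_compactin[OF _ cont_funsD[OF f]] X by (simp add: compact_space_def)
  note unif = rejects_uniform_on_compact[OF this unit lim]
  show "(\<lambda>n. hnorm (C_alg X) (C_mod X) (kaczmarz (C_mod X) (const_seq X e) f n \<ominus>\<^bsub>C_mod X\<^esub> f)) \<longlonglongrightarrow> 0"
    unfolding err
  proof (rule tendstoI)
    fix \<epsilon> :: real assume \<epsilon>: "\<epsilon> > 0"
    have "\<forall>\<^sub>F n in sequentially. \<forall>v\<in>f ` topspace X. norm (rejects e (Suc n) v) < \<epsilon> / 2"
      using unif[of "\<epsilon> / 2"] \<epsilon> by (subst eventually_sequentially_Suc) simp
    then show "\<forall>\<^sub>F n in sequentially. dist (sup_norm X (\<lambda>x\<in>topspace X. - rejects e (Suc n) (f x))) 0 < \<epsilon>"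
    proof eventually_elim
      case (elim n)
      have "sup_norm X (\<lambda>x\<in>topspace X. - rejects e (Suc n) (f x)) \<le> \<epsilon> / 2"
        using elim \<epsilon> by (intro sup_norm_least) (auto simp: less_imp_le)
      moreover have "0 \<le> sup_norm X (\<lambda>x\<in>topspace X. - rejects e (Suc n) (f x))"
        by (intro sup_norm_nonneg X restrict_in_cont_funs continuous_map_minus continuous_intros cont_funsD f)
      ultimately show ?case using \<epsilon> by simp
    qed
  qed
qed

theorem corollary4p2:
  fixes X :: "'x topology"
  assumes "compact_space X" and "Hausdorff_space X"
  shows "hilbert_module (C_alg X) (C_mod X :: ('x \<Rightarrow> complex, 'x \<Rightarrow> 'h::chilbert_space) hilbert_mod) \<and>
    (\<forall>e :: nat \<Rightarrow> 'h.
       stationary e \<and> complete_seq e \<and> (\<forall>n. norm (e n) = 1) \<and>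
       (\<exists>\<mu>. borel_prob_unit_interval \<mu> \<and> lebesgue_singular \<mu> \<and>
            (\<forall>n. cinner (e 0) (e n) = fourier_coeff \<mu> n)) \<longrightarrow>
       effective (C_alg X) (C_mod X) (const_seq X e))"
proof (intro conjI allI impI)
  show "hilbert_module (C_alg X) (C_mod X :: ('x \<Rightarrow> complex, 'x \<Rightarrow> 'h) hilbert_mod)"
    by (rule hilbert_module_C_mod[OF assms(1)])
next
  fix e :: "nat \<Rightarrow> 'h"
  assume *: "stationary e \<and> complete_seq e \<and> (\<forall>n. norm (e n) = 1) \<and>
       (\<exists>\<mu>. borel_prob_unit_interval \<mu> \<and> lebesgue_singular \<mu> \<and>
            (\<forall>n. cinner (e 0) (e n) = fourier_coeff \<mu> n))"
  then have "(\<lambda>n. rejects e n v) \<longlonglongrightarrow> 0" for v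
    using kwapien_mycielski_singular[of e] by blast
  with * show "effective (C_alg X) (C_mod X) (const_seq X e)"
    by (intro effective_const_seq assms(1)) auto
qed

end
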